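(* Let $Q$ be a compactly generated locally compact abelian group, $M$ an LC $Q$-module and $N$ a closed submodule of $M$. Then $\Gamma_Q(N)\subseteq\Gamma_Q(M)$.
   Context: An LC $Q$-module is an LCA group with a continuous action of $Q$ by topological automorphisms. $Q^*$ denotes the set of continuous homomorphisms $Q\to\mathbf{R}$; for $\chi\in Q^*$, $Q_\chi=\{q\in Q:\chi(q)\ge0\}$. For a submonoid $S\subseteq Q$, an LC $Q$-module $H$ is compactly generated over $S$ if there is a compact $K\subseteq H$ such that $H$ is generated as an abstract group by $\{s\cdot k:s\in S,k\in K\}$. Define $\Gamma_Q(H)=\{0\}\cup\{\chi\in Q^*: H \text{ is not compactly generated over any compactly generated submonoid of } Q_\chi\}$. *)

theory Defs
  imports "HOL-Analysis.Analysis"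
begin

text \<open>Locally compact abelian (Hausdorff) groups are modelled by types of class
  topological_ab_group_add and t2_space, with local compactness assumed explicitly.\<close>

definition LCA_group :: "'a::{topological_ab_group_add,t2_space} itself \<Rightarrow> bool" where
  "LCA_group _ \<longleftrightarrow> locally_compact_space (euclidean :: 'a topology)"

definition add_subgroup :: "'a::ab_group_add set \<Rightarrow> bool" where
  "add_subgroup A \<longleftrightarrow> 0 \<in> A \<and> (\<forall>x\<in>A. \<forall>y\<in>A. x + y \<in> A) \<and> (\<forall>x\<in>A. - x \<in> A)"

definition add_submonoid :: "'a::monoid_add set \<Rightarrow> bool" where
  "add_submonoid A \<longleftrightarrow> 0 \<in> A \<and> (\<forall>x\<in>A. \<forall>y\<in>A. x + y \<in> A)"

definition subgroup_gen :: "'a::ab_group_add set \<Rightarrow> 'a set" where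
  "subgroup_gen X = \<Inter>{A. add_subgroup A \<and> X \<subseteq> A}"

definition submonoid_gen :: "'a::monoid_add set \<Rightarrow> 'a set" where
  "submonoid_gen X = \<Inter>{A. add_submonoid A \<and> X \<subseteq> A}"

definition compactly_generated_group :: "'a::{topological_ab_group_add} itself \<Rightarrow> bool" where
  "compactly_generated_group _ \<longleftrightarrow> (\<exists>K::'a set. compact K \<and> subgroup_gen K = UNIV)"

definition compactly_generated_submonoid :: "'a::{topological_ab_group_add} set \<Rightarrow> bool" where
  "compactly_generated_submonoid S \<longleftrightarrow>
     add_submonoid S \<and> (\<exists>K. compact K \<and> K \<subseteq> S \<and> submonoid_gen K = S)"

definition LC_module :: "('q::{topological_ab_group_add,t2_space} \<Rightarrow> 'm::{topological_ab_group_add,t2_space} \<Rightarrow> 'm) \<Rightarrow> bool" where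
  "LC_module act \<longleftrightarrow>
     LCA_group TYPE('m) \<and>
     (\<forall>m. act 0 m = m) \<and>
     (\<forall>p q m. act (p + q) m = act p (act q m)) \<and>
     (\<forall>q x y. act q (x + y) = act q x + act q y) \<and>
     (\<forall>q. homeomorphism UNIV UNIV (act q) (act (- q))) \<and>
     continuous_on UNIV (\<lambda>(q, m). act q m)"

definition closed_submodule :: "('q::ab_group_add \<Rightarrow> 'm::{topological_ab_group_add} \<Rightarrow> 'm) \<Rightarrow> 'm set \<Rightarrow> bool" where
  "closed_submodule act N \<longleftrightarrow> closed N \<and> add_subgroup N \<and> (\<forall>q. \<forall>x\<in>N. act q x \<in> N)"

text \<open>A submodule H (carrier set, with subspace topology) is compactly generated over S.\<close>
definition compactly_generated_over ::
  "('q::ab_group_add \<Rightarrow> 'm::{topological_ab_group_add} \<Rightarrow> 'm) \<Rightarrow> 'q set \<Rightarrow> 'm set \<Rightarrow> bool" where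
  "compactly_generated_over act S H \<longleftrightarrow>
     (\<exists>K. compact K \<and> K \<subseteq> H \<and> H = subgroup_gen {act s k | s k. s \<in> S \<and> k \<in> K})"

definition dual_hom :: "('q::topological_ab_group_add \<Rightarrow> real) \<Rightarrow> bool" where
  "dual_hom chi \<longleftrightarrow> continuous_on UNIV chi \<and> (\<forall>p q. chi (p + q) = chi p + chi q)"

definition half_space :: "('q \<Rightarrow> real) \<Rightarrow> 'q set" where
  "half_space chi = {q. chi q \<ge> 0}"

definition Gamma_Q ::
  "('q::{topological_ab_group_add} \<Rightarrow> 'm::{topological_ab_group_add} \<Rightarrow> 'm) \<Rightarrow> 'm set \<Rightarrow> ('q \<Rightarrow> real) set" where
  "Gamma_Q act H = {\<lambda>_. 0} \<union>
     {chi. dual_hom chi \<and>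
          \<not> (\<exists>S. compactly_generated_submonoid S \<and> S \<subseteq> half_space chi \<and>
                 compactly_generated_over act S H)}"

end

theory Submission
  imports Defs "HOL-Library.Function_Algebras"
begin

text \<open>If \<open>M\<close> is compactly generated over a submonoid \<open>S\<close> generated by a compact set \<open>T\<close>, then every
  closed submodule \<open>N\<close> is compactly generated over the same \<open>S\<close>. Starting from a compact
  neighbourhood \<open>K\<^sub>0\<close> of \<open>0\<close> that generates \<open>M\<close> over \<open>S\<close>, put \<open>K\<^sub>n\<^sub>+\<^sub>1 = K\<^sub>n \<union> T K\<^sub>n\<close> and let \<open>M\<^sub>n\<close> be the
  open subgroup generated by \<open>K\<^sub>n\<close>. The quotients \<open>M\<^sub>n\<^sub>+\<^sub>1 / M\<^sub>n\<close> are discrete and finitely generated,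
  and together they form a finitely generated module over a polynomial ring in finitely many
  variables. By Hilbert's basis theorem \<open>N \<inter> M\<^sub>n\<^sub>+\<^sub>1\<close> is generated by \<open>N \<inter> M\<^sub>n\<close> and \<open>T (N \<inter> M\<^sub>n)\<close> for
  large \<open>n\<close>, so \<open>N\<close> is generated over \<open>S\<close> by some \<open>N \<inter> M\<^sub>d\<close>, a closed subgroup of a compactly
  generated locally compact abelian group. Such a subgroup is compactly generated because its
  trace on a cocompact finitely generated subgroup is coarsely connected.\<close>

section \<open>Generated subgroups and sums of subgroups\<close>

lemma add_subgroup_subgroup_gen: "add_subgroup (subgroup_gen X)"
  unfolding subgroup_gen_def add_subgroup_def by auto

lemma subgroup_gen_superset: "X \<subseteq> subgroup_gen X"
  unfolding subgroup_gen_def by auto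

lemma subgroup_gen_minimal: "X \<subseteq> A \<Longrightarrow> add_subgroup A \<Longrightarrow> subgroup_gen X \<subseteq> A"
  unfolding subgroup_gen_def by auto

lemma subgroup_gen_mono: "X \<subseteq> Y \<Longrightarrow> subgroup_gen X \<subseteq> subgroup_gen Y"
  using subgroup_gen_minimal subgroup_gen_superset add_subgroup_subgroup_gen
  by (metis order_trans)

lemma add_subgroup_zero: "add_subgroup A \<Longrightarrow> 0 \<in> A"
  and add_subgroup_add: "add_subgroup A \<Longrightarrow> x \<in> A \<Longrightarrow> y \<in> A \<Longrightarrow> x + y \<in> A"
  and add_subgroup_minus: "add_subgroup A \<Longrightarrow> x \<in> A \<Longrightarrow> - x \<in> A"
  unfolding add_subgroup_def by auto

lemma add_subgroup_diff: "add_subgroup A \<Longrightarrow> x \<in> A \<Longrightarrow> y \<in> A \<Longrightarrow> x - y \<in> A"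
  using add_subgroup_add[of A x "- y"] add_subgroup_minus[of A y] by simp

lemma add_subgroup_Int: "add_subgroup A \<Longrightarrow> add_subgroup B \<Longrightarrow> add_subgroup (A \<inter> B)"
  unfolding add_subgroup_def by auto

lemma add_subgroup_sums:
  assumes "add_subgroup A" "add_subgroup B"
  shows "add_subgroup {a + b | a b. a \<in> A \<and> b \<in> B}"
  unfolding add_subgroup_def
proof (intro conjI ballI)
  show "0 \<in> {a + b | a b. a \<in> A \<and> b \<in> B}"
    using add_subgroup_zero[OF assms(1)] add_subgroup_zero[OF assms(2)] by force
next
  fix x y assume "x \<in> {a + b | a b. a \<in> A \<and> b \<in> B}" "y \<in> {a + b | a b. a \<in> A \<and> b \<in> B}"
  then obtain a b a' b' where "x = a + b" "y = a' + b'" "a \<in> A" "b \<in> B" "a' \<in> A" "b' \<in> B"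
    by blast
  moreover from this have "x + y = (a + a') + (b + b')" by (simp add: algebra_simps)
  ultimately show "x + y \<in> {a + b | a b. a \<in> A \<and> b \<in> B}"
    using add_subgroup_add assms by blast
next
  fix x assume "x \<in> {a + b | a b. a \<in> A \<and> b \<in> B}"
  then obtain a b where "x = a + b" "a \<in> A" "b \<in> B" by blast
  moreover from this have "- x = - a + - b" by simp
  ultimately show "- x \<in> {a + b | a b. a \<in> A \<and> b \<in> B}"
    using add_subgroup_minus assms by blast
qed

lemma subgroup_gen_Un_subgroup:
  assumes "add_subgroup A" "x \<in> subgroup_gen (A \<union> X)"
  obtains a c where "a \<in> A" "c \<in> subgroup_gen X" "x = a + c"
proof -
  let ?S = "{a + c | a c. a \<in> A \<and> c \<in> subgroup_gen X}"
  have "a \<in> ?S" if "a \<in> A" for a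
    using that add_subgroup_zero[OF add_subgroup_subgroup_gen, of X] by force
  moreover have "c \<in> ?S" if "c \<in> X" for c
    using that add_subgroup_zero[OF assms(1)] subgroup_gen_superset[of X] by force
  ultimately have "subgroup_gen (A \<union> X) \<subseteq> ?S"
    by (intro subgroup_gen_minimal add_subgroup_sums assms add_subgroup_subgroup_gen) blast
  with assms(2) that show ?thesis by blast
qed

lemma additive_subgroup_gen:
  assumes "Modules.additive f" "add_subgroup A" "\<And>x. x \<in> X \<Longrightarrow> f x \<in> A" "x \<in> subgroup_gen X"
  shows "f x \<in> A"
proof -
  interpret Modules.additive f by fact
  have "add_subgroup {x. f x \<in> A}"
    using assms(2) unfolding add_subgroup_def by (auto simp: zero add minus)
  then have "subgroup_gen X \<subseteq> {x. f x \<in> A}"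
    using assms(3) by (intro subgroup_gen_minimal) auto
  with assms(4) show ?thesis by blast
qed

section \<open>Coarse subgroups of lattices\<close>

text \<open>The edges of the Rips graph at scale \<open>D\<close> for the sup distance on the first
  \<open>m\<close> coordinates. Points are labels \<open>x\<close> with coordinates
  \<open>c x\<close>, so several labels may share a vector.\<close>

definition coarse_step :: "('p \<Rightarrow> nat \<Rightarrow> int) \<Rightarrow> nat \<Rightarrow> 'p set \<Rightarrow> int \<Rightarrow> ('p \<times> 'p) set" where
  "coarse_step c m P D = {(x, y). x \<in> P \<and> y \<in> P \<and> (\<forall>i<m. \<bar>c x i - c y i\<bar> \<le> D)}"

text \<open>A subgroup of the lattice up to bounded error: \<open>z\<close> stands in for
  \<open>x - y\<close>, with one bound \<open>C\<close> for all pairs.\<close>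

definition coarse_group :: "('p \<Rightarrow> nat \<Rightarrow> int) \<Rightarrow> nat \<Rightarrow> 'p set \<Rightarrow> bool" where
  "coarse_group c m P \<longleftrightarrow> P \<noteq> {} \<and>
     (\<exists>C. \<forall>x\<in>P. \<forall>y\<in>P. \<exists>z\<in>P. \<forall>i<m. \<bar>c x i - c y i - c z i\<bar> \<le> C)"

lemma coarse_step_rtrancl_mono:
  assumes "P \<subseteq> P'" "D \<le> D'" "(x, y) \<in> (coarse_step c m P D)\<^sup>*"
  shows "(x, y) \<in> (coarse_step c m P' D')\<^sup>*"
proof -
  have "coarse_step c m P D \<subseteq> coarse_step c m P' D'"
    using assms(1,2) unfolding coarse_step_def by fastforce
  with assms(3) rtrancl_mono show ?thesis by blast
qed

lemma coarse_step_rtrancl_sym: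
  "(x, y) \<in> (coarse_step c m P D)\<^sup>* \<Longrightarrow> (y, x) \<in> (coarse_step c m P D)\<^sup>*"
  by (rule symD[OF sym_rtrancl]) (auto simp: sym_def coarse_step_def abs_minus_commute)

text \<open>If the \<open>k\<close>-th coordinate is unbounded on \<open>P\<close>, subtracting a fixed element of \<open>P\<close> whose
  \<open>k\<close>-th coordinate exceeds the additive defect moves any element by bounded steps into a slab
  on which that coordinate is bounded, and this slab is again a coarse subgroup.\<close>

lemma coarse_group_slab:
  assumes P: "coarse_group c m P" and k: "k < m"
    and unbounded: "\<And>H. \<exists>x\<in>P. \<bar>c x k\<bar> > H"
  obtains h D where "coarse_group c m {x\<in>P. \<bar>c x k\<bar> \<le> h}"
    and "\<forall>x\<in>P. \<exists>y\<in>P. \<bar>c y k\<bar> \<le> h \<and> (x, y) \<in> (coarse_step c m P D)\<^sup>*"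
proof -
  obtain C where C: "\<And>x y. x \<in> P \<Longrightarrow> y \<in> P \<Longrightarrow> \<exists>z\<in>P. \<forall>i<m. \<bar>c x i - c y i - c z i\<bar> \<le> C"
    using P unfolding coarse_group_def by blast
  \<comment> \<open>The threshold leaves room for a negative: \<open>o'\<close> approximates
    \<open>p - p\<close> and \<open>q\<close> approximates \<open>o' - p\<close>, so
    \<open>c q k\<close> is within \<open>2 * C\<close> of \<open>- c p k\<close>. Hence
    \<open>P\<close> has elements beyond \<open>C\<close> on both sides.\<close>
  obtain p where p: "p \<in> P" "\<bar>c p k\<bar> > 3 * \<bar>C\<bar>" using unbounded by blast
  obtain o' where o: "o' \<in> P" "\<bar>c o' k\<bar> \<le> C" using C[OF p(1) p(1)] k by force
  obtain q where q: "q \<in> P" "\<bar>c o' k - c p k - c q k\<bar> \<le> C"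
    using C[OF o(1) p(1)] k by blast
  have "\<exists>p1\<in>P. \<exists>p2\<in>P. c p1 k > C \<and> c p2 k < - C"
  proof (cases "c p k > 0")
    case True
    then show ?thesis using p q o by (intro bexI[of _ p] bexI[of _ q]) auto
  next
    case False
    then show ?thesis using p q o by (intro bexI[of _ q] bexI[of _ p]) auto
  qed
  then obtain p1 p2 where p12: "p1 \<in> P" "p2 \<in> P" "c p1 k > C" "c p2 k < - C" by blast
  define h where "h = max \<bar>c p1 k\<bar> \<bar>c p2 k\<bar>"
  define D where "D = Max ((\<lambda>i. \<bar>c p1 i\<bar> + \<bar>c p2 i\<bar>) ` {..<m}) + C"
  have D: "\<bar>c p1 i\<bar> + C \<le> D" "\<bar>c p2 i\<bar> + C \<le> D" if "i < m" for i
  proof -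
    have "\<bar>c p1 i\<bar> + \<bar>c p2 i\<bar> \<le> Max ((\<lambda>i. \<bar>c p1 i\<bar> + \<bar>c p2 i\<bar>) ` {..<m})"
      using that by (intro Max_ge) auto
    then show "\<bar>c p1 i\<bar> + C \<le> D" "\<bar>c p2 i\<bar> + C \<le> D" unfolding D_def by linarith+
  qed
  have C0: "C \<ge> 0" using o by linarith
  have D0: "D \<ge> 0" using D(1)[OF k] C0 by linarith
  \<comment> \<open>Descent on \<open>\<bar>c x k\<bar>\<close>: subtracting whichever of
    \<open>p1\<close>, \<open>p2\<close> has the sign of \<open>c x k\<close> lowers it by at least
    one, even after the error \<open>C\<close>. The bound on the total displacement is kept because
    it controls the defect of the slab.\<close>
  have reduce: "\<exists>y\<in>P. \<bar>c y k\<bar> \<le> h \<and> (x, y) \<in> (coarse_step c m P D)\<^sup>* \<and>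
      (\<forall>i<m. \<bar>c x i - c y i\<bar> \<le> \<bar>c x k\<bar> * D)" if "x \<in> P" for x
    using that
  proof (induction "nat \<bar>c x k\<bar>" arbitrary: x rule: less_induct)
    case less
    show ?case
    proof (cases "\<bar>c x k\<bar> \<le> h")
      case True
      then show ?thesis using less.prems D0 by (intro bexI[of _ x]) auto
    next
      case False
      define r where "r = (if c x k > 0 then p1 else p2)"
      have r: "r \<in> P" using p12 by (simp add: r_def)
      obtain z where z: "z \<in> P" "\<And>i. i < m \<Longrightarrow> \<bar>c x i - c r i - c z i\<bar> \<le> C"
        using C[OF less.prems r] by blast
      have lt: "\<bar>c z k\<bar> + 1 \<le> \<bar>c x k\<bar>"
        using z(2)[OF k] False p12 unfolding h_def r_def by (auto split: if_splits)
      have step: "\<bar>c x i - c z i\<bar> \<le> D" if "i < m" for i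
        using z(2)[OF that] D[OF that] unfolding r_def by (auto split: if_splits)
      obtain y where y: "y \<in> P" "\<bar>c y k\<bar> \<le> h" "(z, y) \<in> (coarse_step c m P D)\<^sup>*"
        "\<And>i. i < m \<Longrightarrow> \<bar>c z i - c y i\<bar> \<le> \<bar>c z k\<bar> * D"
        using less.hyps[OF _ z(1)] lt by force
      have "(x, z) \<in> coarse_step c m P D"
        using step less.prems z(1) unfolding coarse_step_def by simp
      then have "(x, y) \<in> (coarse_step c m P D)\<^sup>*" using y(3) by (rule converse_rtrancl_into_rtrancl)
      moreover have "\<bar>c x i - c y i\<bar> \<le> \<bar>c x k\<bar> * D" if "i < m" for i
      proof -
        have "\<bar>c x i - c y i\<bar> \<le> (\<bar>c z k\<bar> + 1) * D"
          using step[OF that] y(4)[OF that] by (simp add: algebra_simps)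
        also have "\<dots> \<le> \<bar>c x k\<bar> * D" using lt D0 by (intro mult_right_mono)
        finally show ?thesis .
      qed
      ultimately show ?thesis using y by blast
    qed
  qed
  \<comment> \<open>An approximation \<open>w\<close> of \<open>x - y\<close> may leave the slab,
    but \<open>\<bar>c w k\<bar> \<le> 2 * h + C\<close>, so the descent brings it back at cost at
    most \<open>(2 * h + C) * D\<close>.\<close>
  have "\<exists>z\<in>{x\<in>P. \<bar>c x k\<bar> \<le> h}. \<forall>i<m. \<bar>c x i - c y i - c z i\<bar> \<le> C + (2 * h + C) * D"
    if xy: "x \<in> P" "\<bar>c x k\<bar> \<le> h" "y \<in> P" "\<bar>c y k\<bar> \<le> h" for x y
  proof -
    obtain w where w: "w \<in> P" "\<And>i. i < m \<Longrightarrow> \<bar>c x i - c y i - c w i\<bar> \<le> C"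
      using C[OF xy(1,3)] by blast
    obtain z where z: "z \<in> P" "\<bar>c z k\<bar> \<le> h"
      "\<And>i. i < m \<Longrightarrow> \<bar>c w i - c z i\<bar> \<le> \<bar>c w k\<bar> * D"
      using reduce[OF w(1)] by blast
    have "\<bar>c w k\<bar> \<le> 2 * h + C" using w(2)[OF k] xy by linarith
    then have "\<bar>c w k\<bar> * D \<le> (2 * h + C) * D" using D0 by (intro mult_right_mono)
    then have "\<bar>c x i - c y i - c z i\<bar> \<le> C + (2 * h + C) * D" if "i < m" for i
      using z(3)[OF that] w(2)[OF that] by linarith
    with z show ?thesis by blast
  qed
  moreover have "{x\<in>P. \<bar>c x k\<bar> \<le> h} \<noteq> {}" using p12(1) by (auto simp: h_def)
  ultimately have "coarse_group c m {x\<in>P. \<bar>c x k\<bar> \<le> h}"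
    unfolding coarse_group_def by blast
  with reduce that[of h D] show thesis by blast
qed

text \<open>Induction on the number \<open>k\<close> of leading coordinates that may be unbounded.
  If the last of these is bounded after all, the induction hypothesis applies to \<open>P\<close>;
  otherwise every point is joined by bounded steps to a slab to which it applies.\<close>

lemma coarse_group_connected_aux:
  assumes "coarse_group c m P" "\<exists>H. \<forall>x\<in>P. \<forall>i<m. k \<le> i \<longrightarrow> \<bar>c x i\<bar> \<le> H"
  shows "\<exists>D. \<forall>x\<in>P. \<forall>y\<in>P. (x, y) \<in> (coarse_step c m P D)\<^sup>*"
  using assms
proof (induction k arbitrary: P)
  case 0
  then obtain H where H: "\<And>x i. x \<in> P \<Longrightarrow> i < m \<Longrightarrow> \<bar>c x i\<bar> \<le> H" by auto
  have "(x, y) \<in> coarse_step c m P (2 * H)" if "x \<in> P" "y \<in> P" for x y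
  proof -
    have "\<bar>c x i - c y i\<bar> \<le> 2 * H" if "i < m" for i
      using H[OF \<open>x \<in> P\<close> that] H[OF \<open>y \<in> P\<close> that] by linarith
    then show ?thesis using that by (simp add: coarse_step_def)
  qed
  then show ?case by blast
next
  case (Suc k)
  obtain H where H: "\<And>x i. x \<in> P \<Longrightarrow> i < m \<Longrightarrow> Suc k \<le> i \<Longrightarrow> \<bar>c x i\<bar> \<le> H"
    using Suc.prems by auto
  have bounded_above: "\<exists>H. \<forall>x\<in>P'. \<forall>i<m. k \<le> i \<longrightarrow> \<bar>c x i\<bar> \<le> H"
    if "P' \<subseteq> P" "k < m \<Longrightarrow> \<forall>x\<in>P'. \<bar>c x k\<bar> \<le> h" for P' h
  proof (intro exI[of _ "max h H"] ballI allI impI)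
    fix x i assume "x \<in> P'" "i < m" "k \<le> i"
    then show "\<bar>c x i\<bar> \<le> max h H" using that H[of x i] by (cases "i = k") fastforce+
  qed
  show ?case
  proof (cases "k < m \<and> (\<forall>h. \<exists>x\<in>P. \<bar>c x k\<bar> > h)")
    case False
    then obtain h where "k < m \<Longrightarrow> \<forall>x\<in>P. \<bar>c x k\<bar> \<le> h" by (meson not_le)
    with Suc.IH[OF Suc.prems(1)] bounded_above[of P h] show ?thesis by blast
  next
    case True
    then have k: "k < m" and unbounded: "\<And>h. \<exists>x\<in>P. \<bar>c x k\<bar> > h" by auto
    obtain h D where slab: "coarse_group c m {x\<in>P. \<bar>c x k\<bar> \<le> h}"
      and D: "\<forall>x\<in>P. \<exists>y\<in>P. \<bar>c y k\<bar> \<le> h \<and> (x, y) \<in> (coarse_step c m P D)\<^sup>*"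
      using coarse_group_slab[OF Suc.prems(1) k unbounded] .
    obtain D' where D': "\<And>x y. x \<in> {x\<in>P. \<bar>c x k\<bar> \<le> h} \<Longrightarrow> y \<in> {x\<in>P. \<bar>c x k\<bar> \<le> h} \<Longrightarrow>
        (x, y) \<in> (coarse_step c m {x\<in>P. \<bar>c x k\<bar> \<le> h} D')\<^sup>*"
      using Suc.IH[OF slab] bounded_above[of "{x\<in>P. \<bar>c x k\<bar> \<le> h}" h] by blast
    have "(x, y) \<in> (coarse_step c m P (max D D'))\<^sup>*" if xy: "x \<in> P" "y \<in> P" for x y
    proof -
      obtain x' y' where x': "x' \<in> P" "\<bar>c x' k\<bar> \<le> h" "(x, x') \<in> (coarse_step c m P D)\<^sup>*"
        and y': "y' \<in> P" "\<bar>c y' k\<bar> \<le> h" "(y, y') \<in> (coarse_step c m P D)\<^sup>*"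
        using D xy by meson
      have "(x', y') \<in> (coarse_step c m P (max D D'))\<^sup>*"
        using D'[of x' y'] x' y' by (intro coarse_step_rtrancl_mono[of "{x\<in>P. \<bar>c x k\<bar> \<le> h}" P D']) auto
      moreover have "(x, x') \<in> (coarse_step c m P (max D D'))\<^sup>*"
        "(y', y) \<in> (coarse_step c m P (max D D'))\<^sup>*"
        using x'(3) coarse_step_rtrancl_sym[OF y'(3)]
        by (auto intro: coarse_step_rtrancl_mono[of P P D])
      ultimately show ?thesis by (meson rtrancl_trans)
    qed
    then show ?thesis by blast
  qed
qed

lemma coarse_group_connected:
  assumes "coarse_group c m P"
  obtains D where "\<And>x y. x \<in> P \<Longrightarrow> y \<in> P \<Longrightarrow> (x, y) \<in> (coarse_step c m P D)\<^sup>*"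
  \<comment> \<open>With \<open>k = m\<close> the boundedness condition is vacuous.\<close>
  using coarse_group_connected_aux[OF assms, of m] by auto

section \<open>Closed subgroups of compactly generated groups\<close>

lemma compact_sums_group:
  fixes A B :: "'a::topological_ab_group_add set"
  assumes "compact A" "compact B"
  shows "compact {a + b | a b. a \<in> A \<and> b \<in> B}"
proof -
  have "{a + b | a b. a \<in> A \<and> b \<in> B} = (\<lambda>(a, b). a + b) ` (A \<times> B)" by auto
  moreover have "continuous_on (A \<times> B) (\<lambda>(a, b). a + b)"
    unfolding case_prod_beta by (intro continuous_intros)
  ultimately show ?thesis using compact_Times[OF assms] by (simp add: compact_continuous_image)
qed

lemma open_vimage_diff:
  fixes V :: "'a::topological_ab_group_add set"
  assumes "open V" shows "open {x. x - a \<in> V}"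
  using open_vimage[OF assms, of "\<lambda>x. x - a"]
  by (simp add: vimage_def continuous_intros)

lemma compact_subset_finite_translates:
  fixes V :: "'a::topological_ab_group_add set"
  assumes "compact K" "open V" "0 \<in> V"
  obtains F where "finite F" "F \<subseteq> K" "\<forall>x\<in>K. \<exists>f\<in>F. x - f \<in> V"
proof -
  have "K \<subseteq> (\<Union>a\<in>K. {x. x - a \<in> V})" using assms(3) by auto
  then obtain F where "F \<subseteq> K" "finite F" "K \<subseteq> (\<Union>a\<in>F. {x. x - a \<in> V})"
    using compactE_image[OF assms(1), of K "\<lambda>a. {x. x - a \<in> V}"] open_vimage_diff[OF assms(2)]
    by metis
  then show thesis by (intro that[of F]) blast+
qed

lemma open_subgroup:
  fixes A :: "'a::topological_ab_group_add set"
  assumes A: "add_subgroup A" and "open V" "0 \<in> V" "V \<subseteq> A"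
  shows "open A" "closed A"
proof -
  have "A = (\<Union>a\<in>A. {x. x - a \<in> V})"
    using assms add_subgroup_add[OF A] by (force dest: subsetD)
  moreover have "open (\<Union>a\<in>A. {x. x - a \<in> V})" using open_vimage_diff[OF assms(2)] by blast
  ultimately show "open A" by simp
  \<comment> \<open>A translate of \<open>V\<close> stays in one coset of \<open>A\<close>, so the
    complement is a union of translates as well.\<close>
  have "- A = (\<Union>a\<in>-A. {x. x - a \<in> V})"
  proof (intro equalityI subsetI)
    fix x assume "x \<in> - A" then show "x \<in> (\<Union>a\<in>-A. {x. x - a \<in> V})" using assms(3) by (auto intro!: bexI[of _ x])
  next
    fix x assume "x \<in> (\<Union>a\<in>-A. {x. x - a \<in> V})"
    then obtain a where "a \<notin> A" "x - a \<in> A" using assms(4) by auto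
    then show "x \<in> - A" using add_subgroup_diff[OF A, of x "x - a"] by auto
  qed
  moreover have "open (\<Union>a\<in>-A. {x. x - a \<in> V})" using open_vimage_diff[OF assms(2)] by blast
  ultimately show "closed A" by (simp add: closed_def)
qed

section \<open>Integer multiples and integer linear combinations\<close>

text \<open>The action of the integers on an abelian group; at least one of the two sums is
  empty.\<close>

definition int_scale :: "int \<Rightarrow> 'a::ab_group_add \<Rightarrow> 'a" where
  "int_scale n x = (\<Sum>i<nat n. x) - (\<Sum>i<nat (- n). x)"

lemma int_scale_zero [simp]: "int_scale 0 x = 0"
  by (simp add: int_scale_def)

lemma int_scale_plus_one: "int_scale (n + 1) x = int_scale n x + x"
proof (cases "n \<ge> 0")
  case True
  then have "nat (n + 1) = Suc (nat n)" "nat (- n) = 0" "nat (- (n + 1)) = 0" by auto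
  then show ?thesis by (simp add: int_scale_def)
next
  case False
  then have "nat (- n) = Suc (nat (- (n + 1)))" "nat n = 0" "nat (n + 1) = 0" by auto
  then show ?thesis by (simp add: int_scale_def)
qed

lemma int_scale_one [simp]: "int_scale 1 x = x"
  using int_scale_plus_one[of 0 x] by simp

lemma int_scale_add: "int_scale (m + n) x = int_scale m x + int_scale n x"
proof (induction n rule: int_induct[where k = 0])
  case (step1 i)
  then show ?case using int_scale_plus_one[of "m + i" x] int_scale_plus_one[of i x]
    by (simp add: algebra_simps)
next
  case (step2 i)
  then show ?case using int_scale_plus_one[of "m + (i - 1)" x] int_scale_plus_one[of "i - 1" x]
    by (simp add: algebra_simps)
qed simp

lemma int_scale_minus: "int_scale (- n) x = - int_scale n x"
  using int_scale_add[of n "- n" x] by (simp add: add_eq_0_iff)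

lemma int_scale_diff: "int_scale (m - n) x = int_scale m x - int_scale n x"
  using int_scale_add[of m "- n" x] by (simp add: int_scale_minus)

text \<open>The homomorphism sending the \<open>i\<close>-th unit vector to \<open>f i\<close>;
  entries of \<open>v\<close> from index \<open>m\<close> on are ignored.\<close>

definition lattice_sum :: "(nat \<Rightarrow> 'a::ab_group_add) \<Rightarrow> nat \<Rightarrow> (nat \<Rightarrow> int) \<Rightarrow> 'a" where
  "lattice_sum f m v = (\<Sum>i<m. int_scale (v i) (f i))"

lemma lattice_sum_diff:
  "lattice_sum f m (\<lambda>i. v i - w i) = lattice_sum f m v - lattice_sum f m w"
  by (simp add: lattice_sum_def int_scale_diff sum_subtractf)

lemma lattice_sum_add_unit:
  assumes "j < m"
  shows "lattice_sum f m (\<lambda>i. v i + of_bool (i = j)) = lattice_sum f m v + f j"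
proof -
  have "(\<Sum>i<m. int_scale (of_bool (i = j)) (f i)) = (\<Sum>i<m. if i = j then f i else 0)"
    by (intro sum.cong) auto
  then show ?thesis using assms
    by (simp add: lattice_sum_def int_scale_add sum.distrib)
qed

lemma finite_lattice_sum_box: "finite {lattice_sum f m v | v. \<forall>i<m. \<bar>v i\<bar> \<le> D}"
proof (rule finite_subset)
  show "finite (lattice_sum f m ` PiE {..<m} (\<lambda>_. {- D..D}))"
    by (intro finite_imageI finite_PiE) auto
  show "{lattice_sum f m v | v. \<forall>i<m. \<bar>v i\<bar> \<le> D} \<subseteq> lattice_sum f m ` PiE {..<m} (\<lambda>_. {- D..D})"
  proof clarify
    fix v :: "nat \<Rightarrow> int" assume "\<forall>i<m. \<bar>v i\<bar> \<le> D"
    \<comment> \<open>Nothing constrains \<open>v\<close> beyond \<open>m\<close>; only the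
      restrictions range over a finite set.\<close>
    then have "restrict v {..<m} \<in> PiE {..<m} (\<lambda>_. {- D..D})" by (auto simp: abs_le_iff minus_le_iff)
    moreover have "lattice_sum f m v = lattice_sum f m (restrict v {..<m})"
      by (simp add: lattice_sum_def)
    ultimately show "lattice_sum f m v \<in> lattice_sum f m ` PiE {..<m} (\<lambda>_. {- D..D})" by blast
  qed
qed

text \<open>Up to a compact error, \<open>subgroup_gen K\<close> consists of integer combinations of
  finitely many elements. The integer vectors approximating elements of \<open>B\<close> form a
  coarse subgroup, hence are connected by bounded steps. A bounded step moves the element of
  \<open>B\<close> by an element of a compact set, and these differences generate
  \<open>B\<close>.\<close>

lemma closed_subgroup_compactly_generated:
  fixes K :: "'a::{topological_ab_group_add,t2_space} set"
  assumes K: "compact K" "open V" "0 \<in> V" "V \<subseteq> K"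
    and B: "add_subgroup B" "closed B" "B \<subseteq> subgroup_gen K"
  obtains L where "compact L" "L \<subseteq> B" "subgroup_gen L = B"
proof -
  define KK where "KK = {a + b | a b. a \<in> K \<and> b \<in> uminus ` K}"
  have compact_minus: "compact (uminus ` X)" if "compact X" for X :: "'a set"
    using that by (intro compact_continuous_image continuous_intros)
  have KK: "compact KK" "0 \<in> KK" unfolding KK_def
    using compact_sums_group[OF K(1) compact_minus[OF K(1)]] K(3,4) by force+
  have KKV: "K \<subseteq> KK" "V \<subseteq> KK" using K(3,4) unfolding KK_def by force+
  define K4 where "K4 = {a + b | a b. a \<in> KK \<and> b \<in> uminus ` KK}"
  have K4: "compact K4"
    unfolding K4_def by (intro compact_sums_group compact_minus KK)
  \<comment> \<open>\<open>K4\<close> is \<open>KK - KK\<close>. Covering it by finitely many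
    translates of \<open>V\<close> makes \<open>KK\<close> closed under subtraction up to a single
    \<open>f j\<close>.\<close>
  obtain F where F: "finite F" "F \<subseteq> K4" "\<forall>x\<in>K4. \<exists>f\<in>F. x - f \<in> V"
    using compact_subset_finite_translates[OF K4 K(2,3)] .
  obtain f :: "nat \<Rightarrow> 'a" and m where f: "F = f ` {..<m}"
    using F(1) finite_imp_nat_seg_image_inj_on[of F] by (auto simp: lessThan_def)
  have quasi: "\<exists>j<m. x - y - f j \<in> KK" if "x \<in> KK" "y \<in> KK" for x y
  proof -
    have "x + - y \<in> K4" unfolding K4_def using that by blast
    then obtain g where "g \<in> F" "x + - y - g \<in> V" using F(3) by blast
    then show ?thesis using f KKV by auto
  qed
  define E where "E = {x. \<exists>v. x - lattice_sum f m v \<in> KK}"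
  have E_diff: "\<exists>z. x - y - lattice_sum f m z \<in> KK \<and> (\<forall>i. \<bar>v i - w i - z i\<bar> \<le> 1)"
    if x: "x - lattice_sum f m v \<in> KK" and y: "y - lattice_sum f m w \<in> KK" for x y v w
  proof -
    obtain j where j: "j < m"
      "(x - lattice_sum f m v) - (y - lattice_sum f m w) - f j \<in> KK"
      using quasi[OF x y] by blast
    \<comment> \<open>The correction by \<open>f j\<close> changes the difference of the vectors by
      one unit vector, whence the error bound 1.\<close>
    let ?z = "\<lambda>i. v i - w i + of_bool (i = j)"
    have "x - y - lattice_sum f m ?z = (x - lattice_sum f m v) - (y - lattice_sum f m w) - f j"
      unfolding lattice_sum_add_unit[OF j(1)] lattice_sum_diff by (simp add: algebra_simps)
    then have "x - y - lattice_sum f m ?z \<in> KK" using j(2) by (rule ssubst)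
    moreover have "\<forall>i. \<bar>v i - w i - ?z i\<bar> \<le> 1" by auto
    ultimately show ?thesis by blast
  qed
  have KK_E: "KK \<subseteq> E"
    unfolding E_def by (auto intro!: exI[of _ "\<lambda>_. 0"] simp: lattice_sum_def)
  have E_diff': "x - y \<in> E" if "x \<in> E" "y \<in> E" for x y
    using E_diff that unfolding E_def by blast
  have E0: "0 \<in> E" using KK_E KK by blast
  have "add_subgroup E"
    unfolding add_subgroup_def
  proof (intro conjI ballI)
    show minus: "- x \<in> E" if "x \<in> E" for x using E_diff'[OF E0 that] by simp
    show "x + y \<in> E" if "x \<in> E" "y \<in> E" for x y using E_diff'[OF that(1) minus[OF that(2)]] by simp
  qed (fact E0)
  then have BE: "B \<subseteq> E" using B(3) subgroup_gen_minimal[of K E] KK_E KKV by blast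
  \<comment> \<open>An element of \<open>B\<close> can have many approximating vectors, so the
    points are pairs and \<open>snd\<close> gives the coordinates.\<close>
  define P where "P = {(b, v). b \<in> B \<and> b - lattice_sum f m v \<in> KK}"
  have P0: "(0, \<lambda>_. 0) \<in> P"
    using KK add_subgroup_zero[OF B(1)] by (simp add: P_def lattice_sum_def)
  have "coarse_group snd m P"
    unfolding coarse_group_def
  proof (intro conjI exI[of _ 1] ballI)
    fix x y assume "x \<in> P" "y \<in> P"
    moreover obtain b v b' w where [simp]: "x = (b, v)" "y = (b', w)" by fastforce
    ultimately obtain z where "b - b' - lattice_sum f m z \<in> KK" "\<forall>i. \<bar>v i - w i - z i\<bar> \<le> 1"
      "b - b' \<in> B"
      using E_diff[of b v b' w] add_subgroup_diff[OF B(1)] unfolding P_def by blast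
    then show "\<exists>z\<in>P. \<forall>i<m. \<bar>snd x i - snd y i - snd z i\<bar> \<le> 1"
      by (intro bexI[of _ "(b - b', z)"]) (auto simp: P_def)
  qed (use P0 in blast)
  then obtain D where D: "\<And>x y. x \<in> P \<Longrightarrow> y \<in> P \<Longrightarrow> (x, y) \<in> (coarse_step snd m P D)\<^sup>*"
    using coarse_group_connected by blast
  \<comment> \<open>Consecutive elements of a walk differ by a difference of two errors from
    \<open>KK\<close> plus a combination with coefficients bounded by \<open>D\<close>.\<close>
  define K2 where "K2 = {a + b | a b. a \<in> K4 \<and> b \<in> {lattice_sum f m v | v. \<forall>i<m. \<bar>v i\<bar> \<le> D}}"
  have K2: "compact K2" unfolding K2_def
    by (intro compact_sums_group K4 finite_imp_compact finite_lattice_sum_box)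
  have "b \<in> subgroup_gen (K2 \<inter> B)" if "((0, \<lambda>_. 0), (b, v)) \<in> (coarse_step snd m P D)\<^sup>*" for b v
    using that
  proof (induction b v rule: rtrancl_induct2)
    case refl
    then show ?case by (intro add_subgroup_zero add_subgroup_subgroup_gen)
  next
    case (step b v b' w)
    then have *: "b \<in> B" "b' \<in> B" "b - lattice_sum f m v \<in> KK" "b' - lattice_sum f m w \<in> KK"
      "\<forall>i<m. \<bar>w i - v i\<bar> \<le> D"
      by (auto simp: coarse_step_def P_def abs_minus_commute)
    have "b' - b = ((b' - lattice_sum f m w) + - (b - lattice_sum f m v)) + lattice_sum f m (\<lambda>i. w i - v i)"
      by (simp add: lattice_sum_diff)
    moreover have "(b' - lattice_sum f m w) + - (b - lattice_sum f m v) \<in> K4"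
      unfolding K4_def using *(3,4) by blast
    ultimately have "b' - b \<in> K2" unfolding K2_def using *(5) by blast
    then have "b' - b \<in> subgroup_gen (K2 \<inter> B)"
      using * add_subgroup_diff[OF B(1)] subgroup_gen_superset[of "K2 \<inter> B"] by blast
    then show ?case
      using add_subgroup_add[OF add_subgroup_subgroup_gen step.IH, of "b' - b"] by simp
  qed
  then have "B \<subseteq> subgroup_gen (K2 \<inter> B)"
    using D[OF P0] BE unfolding E_def P_def by blast
  then have "subgroup_gen (K2 \<inter> B) = B"
    using subgroup_gen_minimal[OF _ B(1), of "K2 \<inter> B"] by blast
  with that[of "K2 \<inter> B"] compact_Int_closed[OF K2 B(2)] show thesis by blast
qed

section \<open>Noetherian groups with operators\<close>

text \<open>The submodules of \<open>X / Z\<close> over the operators \<open>R\<close>, represented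
  by their preimages so that no quotient has to be formed.\<close>

definition invariant_subgroups :: "('a::ab_group_add \<Rightarrow> 'a) set \<Rightarrow> 'a set \<Rightarrow> 'a set \<Rightarrow> 'a set set" where
  "invariant_subgroups R Z X = {A. add_subgroup A \<and> Z \<subseteq> A \<and> A \<subseteq> X \<and> (\<forall>r\<in>R. r ` A \<subseteq> A)}"

definition noetherian :: "('a::ab_group_add \<Rightarrow> 'a) set \<Rightarrow> 'a set \<Rightarrow> 'a set \<Rightarrow> bool" where
  "noetherian R Z X \<longleftrightarrow> (\<forall>A. incseq A \<longrightarrow> range A \<subseteq> invariant_subgroups R Z X \<longrightarrow>
     (\<exists>d. \<forall>n\<ge>d. A n = A d))"

lemma noetherianD:
  assumes "noetherian R Z X" "incseq A" "\<And>n. A n \<in> invariant_subgroups R Z X"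
  obtains d where "\<forall>n\<ge>d. A n = A d"
  using assms unfolding noetherian_def by blast

section \<open>Ascending chains in finitely generated abelian groups\<close>

text \<open>If some positive integer occurs, let \<open>g\<close> be the least one in the union.
  From the index \<open>d\<close> at which \<open>g\<close> appears, division with remainder shows
  that every \<open>I n\<close> consists of multiples of \<open>g\<close>.\<close>

lemma incseq_int_subgroups_stabilise:
  fixes I :: "nat \<Rightarrow> int set"
  assumes "incseq I" and I: "\<And>n. add_subgroup (I n)"
  obtains d where "\<forall>n\<ge>d. I n = I d"
proof (cases "\<exists>n. \<exists>a\<in>I n. a > 0")
  case False
  have "I n = {0}" for n
  proof (intro equalityI subsetI)
    fix x assume "x \<in> I n"
    then have "\<not> x > 0" "\<not> - x > 0" using False add_subgroup_minus[OF I[of n]] by blast+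
    then show "x \<in> {0}" by simp
  qed (use add_subgroup_zero[OF I] in blast)
  then show ?thesis using that[of 0] by metis
next
  case True
  then have "\<exists>k::nat. k > 0 \<and> (\<exists>n. int k \<in> I n)"
    by (metis of_nat_0_less_iff zero_less_imp_eq_int)
  define g where "g = (LEAST k::nat. k > 0 \<and> (\<exists>n. int k \<in> I n))"
  have "g > 0 \<and> (\<exists>n. int g \<in> I n)"
    unfolding g_def by (rule LeastI_ex) fact
  then obtain d where g: "g > 0" "int g \<in> I d" by blast
  have mult: "n * int g \<in> A" if "add_subgroup A" "int g \<in> A" for n A
  proof (induction n rule: int_induct[where k = 0])
    case (step1 i)
    then show ?case using add_subgroup_add[OF that(1) _ that(2)] by (simp add: ring_distribs)
  next
    case (step2 i)
    then show ?case using add_subgroup_diff[OF that(1) _ that(2)] by (simp add: ring_distribs)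
  qed (use add_subgroup_zero[OF that(1)] in simp)
  have "I n = I d" if "n \<ge> d" for n
  proof
    show "I d \<subseteq> I n" using assms(1) that by (simp add: incseq_def)
    show "I n \<subseteq> I d"
    proof
      fix x assume "x \<in> I n"
      moreover have "int g \<in> I n" using g(2) \<open>I d \<subseteq> I n\<close> by blast
      ultimately have "x - (x div int g) * int g \<in> I n"
        by (intro add_subgroup_diff mult I)
      then have "x mod int g \<in> I n" by (simp add: minus_div_mult_eq_mod)
      moreover have "0 \<le> x mod int g" "x mod int g < int g" using g(1) by auto
      ultimately have "x mod int g = 0"
        using not_less_Least[of "nat (x mod int g)" "\<lambda>k. k > 0 \<and> (\<exists>n. int k \<in> I n)"]
        unfolding g_def[symmetric] by (metis int_nat_eq linorder_not_less nat_less_iff order_le_imp_less_or_eq zero_less_nat_eq)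
      then show "x \<in> I d" using mult[OF I g(2), of "x div int g"] by (metis div_mult_mod_eq add.right_neutral)
    qed
  qed
  then show ?thesis using that by blast
qed

text \<open>An extension argument: a chain is constant once both its traces on \<open>X\<close> and
  the subgroups \<open>I n\<close> of integers occurring as coefficients of \<open>f\<close> are
  constant.\<close>

lemma noetherian_add_generator:
  assumes X: "add_subgroup X" "Z \<subseteq> X" and noeth: "noetherian {} Z X"
  shows "noetherian {} Z {x + y | x y. x \<in> X \<and> y \<in> range (\<lambda>n. int_scale n f)}"
  unfolding noetherian_def
proof (intro allI impI)
  let ?Y = "{x + y | x y. x \<in> X \<and> y \<in> range (\<lambda>n. int_scale n f)}"
  fix A assume A: "incseq A" "range A \<subseteq> invariant_subgroups {} Z ?Y"
  have "A n \<in> invariant_subgroups {} Z ?Y" for n using A(2) by blast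
  then have sub: "add_subgroup (A n)" "Z \<subseteq> A n" "A n \<subseteq> ?Y" for n
    by (simp_all only: invariant_subgroups_def mem_Collect_eq)
  have mono: "A i \<subseteq> A j" if "i \<le> j" for i j using A(1) that by (simp add: incseq_def)
  define I where "I n = {k. \<exists>x\<in>X. x + int_scale k f \<in> A n}" for n
  have "add_subgroup (I n)" for n
    unfolding add_subgroup_def
  proof (intro conjI ballI)
    show "0 \<in> I n" using add_subgroup_zero[OF X(1)] add_subgroup_zero[OF sub(1)] by (force simp: I_def)
  next
    fix a b assume "a \<in> I n" "b \<in> I n"
    then obtain x y where *: "x \<in> X" "y \<in> X" "x + int_scale a f \<in> A n" "y + int_scale b f \<in> A n"
      by (auto simp: I_def)
    have "(x + y) + int_scale (a + b) f = (x + int_scale a f) + (y + int_scale b f)"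
      by (simp add: int_scale_add algebra_simps)
    then show "a + b \<in> I n"
      unfolding I_def using * add_subgroup_add[OF sub(1)] add_subgroup_add[OF X(1)] by (metis (mono_tags, lifting) mem_Collect_eq)
  next
    fix a assume "a \<in> I n"
    then obtain x where *: "x \<in> X" "x + int_scale a f \<in> A n" by (auto simp: I_def)
    have "- x + int_scale (- a) f = - (x + int_scale a f)" by (simp add: int_scale_minus)
    then show "- a \<in> I n"
      unfolding I_def using * add_subgroup_minus[OF sub(1)] add_subgroup_minus[OF X(1)] by (metis (mono_tags, lifting) mem_Collect_eq)
  qed
  moreover have "incseq I"
    unfolding incseq_def I_def using mono by blast
  ultimately obtain d1 where d1: "\<forall>n\<ge>d1. I n = I d1"
    using incseq_int_subgroups_stabilise by blast
  have "incseq (\<lambda>n. A n \<inter> X)" unfolding incseq_def using mono by blast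
  moreover have "A n \<inter> X \<in> invariant_subgroups {} Z X" for n
    using sub[of n] X by (auto simp: invariant_subgroups_def add_subgroup_Int)
  ultimately obtain d2 where d2: "\<forall>n\<ge>d2. A n \<inter> X = A d2 \<inter> X"
    using noetherianD[OF noeth] by blast
  define d where "d = max d1 d2"
  have "A n \<subseteq> A d" if "n \<ge> d" for n
  proof
    fix v assume v: "v \<in> A n"
    then obtain x k where xk: "v = x + int_scale k f" "x \<in> X" using sub(3)[of n] by blast
    then have "k \<in> I n" using v by (auto simp: I_def)
    then have "k \<in> I d" using d1 that by (metis d_def max.bounded_iff max.cobounded1)
    then obtain y where y: "y \<in> X" "y + int_scale k f \<in> A d" by (auto simp: I_def)
    \<comment> \<open>Two elements with the same coefficient of \<open>f\<close> differ by an
      element of \<open>X\<close>, to which the stable trace applies.\<close>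
    have "v - (y + int_scale k f) \<in> A n" using v y(2) mono[OF that] add_subgroup_diff[OF sub(1)] by blast
    moreover have "v - (y + int_scale k f) = x - y" by (simp add: xk)
    ultimately have "x - y \<in> A n \<inter> X" using add_subgroup_diff[OF X(1) xk(2) y(1)] by simp
    then have "x - y \<in> A d" using d2 that by (metis IntD1 d_def max.bounded_iff max.cobounded2)
    then have "(x - y) + (y + int_scale k f) \<in> A d" using y(2) add_subgroup_add[OF sub(1)] by blast
    then show "v \<in> A d" by (simp add: xk)
  qed
  then show "\<exists>d. \<forall>n\<ge>d. A n = A d" using mono by blast
qed

lemma noetherian_finitely_generated:
  assumes "finite F" "add_subgroup Z"
  obtains X where "add_subgroup X" "Z \<union> F \<subseteq> X" "noetherian {} Z X"
proof -
  have "\<exists>X. add_subgroup X \<and> Z \<union> F \<subseteq> X \<and> noetherian {} Z X"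
    using assms(1)
  proof (induction F)
    case empty
    have "A = Z" if "A \<in> invariant_subgroups {} Z Z" for A
      using that by (auto simp: invariant_subgroups_def)
    then have "noetherian {} Z Z" unfolding noetherian_def by (metis rangeI subsetD)
    then show ?case using assms(2) by auto
  next
    case (insert f F)
    then obtain X where X: "add_subgroup X" "Z \<union> F \<subseteq> X" "noetherian {} Z X" by blast
    let ?G = "range (\<lambda>n. int_scale n f)"
    let ?Y = "{x + y | x y. x \<in> X \<and> y \<in> ?G}"
    have G: "add_subgroup ?G"
      unfolding add_subgroup_def
      by (auto simp flip: int_scale_add int_scale_minus) (metis int_scale_zero rangeI)
    have "X \<subseteq> ?Y" using add_subgroup_zero[OF G] by force
    moreover have "f \<in> ?G" by (metis int_scale_one rangeI)
    then have "f \<in> ?Y" using add_subgroup_zero[OF X(1)] by force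
    moreover have "add_subgroup ?Y" by (intro add_subgroup_sums X G)
    moreover have "noetherian {} Z ?Y" using X by (intro noetherian_add_generator) auto
    ultimately show ?case using X(2) by blast
  qed
  then show thesis using that by blast
qed

section \<open>Hilbert's basis theorem for commuting operators\<close>

text \<open>One \<open>d\<close> has to serve all rows. The diagonal is constant from some
  \<open>k\<close> on; the rows up to \<open>k\<close> are finitely many, and each later row is
  squeezed between \<open>L k k\<close> and a diagonal entry equal to it.\<close>

lemma incseq2_stabilise:
  fixes L :: "nat \<Rightarrow> nat \<Rightarrow> 'a set"
  assumes mono: "\<And>n n' j j'. n \<le> n' \<Longrightarrow> j \<le> j' \<Longrightarrow> L n j \<subseteq> L n' j'"
    and acc: "\<And>A. incseq A \<Longrightarrow> range A \<subseteq> {L n j | n j. True} \<Longrightarrow> \<exists>d. \<forall>n\<ge>d. A n = A d"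
  obtains d where "\<forall>n. \<forall>j\<ge>d. L n j = L n d"
proof -
  have "incseq (\<lambda>k. L k k)" using mono by (simp add: incseq_def)
  then obtain k where k: "\<And>n. n \<ge> k \<Longrightarrow> L n n = L k k" using acc[of "\<lambda>k. L k k"] by blast
  have "\<exists>d. \<forall>j\<ge>d. L n j = L n d" for n
    using acc[of "L n"] mono[of n n] by (auto simp: incseq_def)
  then obtain e where e: "\<And>n j. j \<ge> e n \<Longrightarrow> L n j = L n (e n)" by metis
  define d where "d = Max (insert k (e ` {..k}))"
  have dk: "k \<le> d" and de: "n \<le> k \<Longrightarrow> e n \<le> d" for n
    unfolding d_def by (intro Max_ge; simp)+
  have "L n j = L n d" if "j \<ge> d" for n j
  proof (cases "n \<le> k")
    case True
    then show ?thesis using e[of n j] e[of n d] de that by force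
  next
    case False
    then have "L n j \<subseteq> L (max n j) (max n j)" "L k k \<subseteq> L n d"
      using mono dk by simp_all
    moreover have "L (max n j) (max n j) = L k k" using False by (intro k) auto
    ultimately show ?thesis using mono[of n n d j] that by blast
  qed
  then show thesis using that by blast
qed

text \<open>Hilbert's basis theorem for a group with commuting operators. The sets \<open>L n j\<close> play the
  role of the modules of leading coefficients in degree \<open>n\<close>; no polynomial ring is needed.\<close>

lemma noetherian_adjoin_operator:
  assumes X: "add_subgroup X" "Z \<subseteq> X" "\<And>r. r \<in> R \<Longrightarrow> r ` X \<subseteq> X"
    and noeth: "noetherian R Z X"
    and additive: "Modules.additive t" "\<And>r. r \<in> R \<Longrightarrow> Modules.additive r"
    and comm: "\<And>r x. r \<in> R \<Longrightarrow> r (t x) = t (r x)"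
    and Z: "t ` Z \<subseteq> Z"
  obtains Y where "add_subgroup Y" "X \<subseteq> Y" "\<And>r. r \<in> insert t R \<Longrightarrow> r ` Y \<subseteq> Y"
    "noetherian (insert t R) Z Y"
proof -
  interpret t: Modules.additive t by fact
  have tn: "(t ^^ n) (x + y) = (t ^^ n) x + (t ^^ n) y" "(t ^^ n) (- x) = - (t ^^ n) x"
    "(t ^^ n) 0 = 0" for n x y
    by (induction n) (auto simp: t.add t.minus t.zero)
  have rtn: "r ((t ^^ n) x) = (t ^^ n) (r x)" if "r \<in> R" for r n x
    by (induction n) (auto simp: comm[OF that])
  have tnZ: "(t ^^ n) z \<in> Z" if "z \<in> Z" for n z
    by (induction n) (use that Z in auto)
  \<comment> \<open>\<open>D n\<close> is the sum of the images of \<open>X\<close> under the powers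
    of \<open>t\<close> below \<open>n\<close>: the polynomials of degree less than
    \<open>n\<close>. Thus \<open>D 0\<close> is trivial and \<open>D 1\<close> is
    \<open>X\<close>.\<close>
  define D where "D = rec_nat {0} (\<lambda>n E. {(t ^^ n) x + y | x y. x \<in> X \<and> y \<in> E})"
  have D0: "D 0 = {0}" and DSuc: "D (Suc n) = {(t ^^ n) x + y | x y. x \<in> X \<and> y \<in> D n}" for n
    by (simp_all add: D_def)
  have D: "add_subgroup (D n)" for n
  proof (induction n)
    case 0
    then show ?case by (simp add: D0 add_subgroup_def)
  next
    case (Suc n)
    have "add_subgroup ((t ^^ n) ` X)"
      using X(1) unfolding add_subgroup_def
      by (auto simp flip: tn(1,2)) (metis imageI tn(3))
    moreover have "D (Suc n) = {a + b | a b. a \<in> (t ^^ n) ` X \<and> b \<in> D n}"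
      unfolding DSuc by auto
    ultimately show ?case using add_subgroup_sums[OF _ Suc, of "(t ^^ n) ` X"] by (simp only:)
  qed
  have D_Suc: "D n \<subseteq> D (Suc n)" for n
    unfolding DSuc using add_subgroup_zero[OF X(1)] tn(3)[of n] by force
  have D_mono: "D n \<subseteq> D n'" if "n \<le> n'" for n n'
    using that D_Suc by (rule lift_Suc_mono_le[rotated])
  have tD: "t y \<in> D (Suc n)" if "y \<in> D n" for n y
    using that
  proof (induction n arbitrary: y)
    case 0
    then show ?case using D_Suc[of 0] by (auto simp: D0 t.zero)
  next
    case (Suc n)
    then obtain x w where "y = (t ^^ n) x + w" "x \<in> X" "w \<in> D n" unfolding DSuc by blast
    then show ?case using Suc.IH[of w] unfolding DSuc[of "Suc n"] by (auto simp: t.add)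
  qed
  have rD: "r y \<in> D n" if "y \<in> D n" "r \<in> R" for n y r
    using that(1)
  proof (induction n arbitrary: y)
    case 0
    then show ?case using Modules.additive.zero[OF additive(2)[OF that(2)]] by (auto simp: D0)
  next
    case (Suc n)
    then obtain x w where "y = (t ^^ n) x + w" "x \<in> X" "w \<in> D n" unfolding DSuc by blast
    then show ?case using Suc.IH[of w] X(3)[OF that(2)] unfolding DSuc
      by (auto simp: Modules.additive.add[OF additive(2)[OF that(2)]] rtn[OF that(2)])
  qed
  define Y where "Y = (\<Union>n. D n)"
  have Y: "add_subgroup Y"
    unfolding add_subgroup_def
  proof (intro conjI ballI)
    show "0 \<in> Y" using D0 by (auto simp: Y_def)
    show "- x \<in> Y" if "x \<in> Y" for x using that add_subgroup_minus[OF D] by (auto simp: Y_def)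
    show "x + y \<in> Y" if xy: "x \<in> Y" "y \<in> Y" for x y
    proof -
      obtain n n' where "x \<in> D n" "y \<in> D n'" using xy by (auto simp: Y_def)
      then have "x \<in> D (max n n')" "y \<in> D (max n n')"
        using D_mono[of n "max n n'"] D_mono[of n' "max n n'"] by auto
      then show ?thesis using add_subgroup_add[OF D] by (auto simp: Y_def)
    qed
  qed
  have XY: "X \<subseteq> Y"
  proof -
    have "X = D 1" using DSuc[of 0] by (simp add: D0)
    then show ?thesis by (auto simp: Y_def)
  qed
  have invY: "r ` Y \<subseteq> Y" if "r \<in> insert t R" for r
    using that tD rD by (fastforce simp: Y_def)
  have "noetherian (insert t R) Z Y"
    unfolding noetherian_def
  proof (intro allI impI)
    fix A assume A: "incseq A" "range A \<subseteq> invariant_subgroups (insert t R) Z Y"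
    have "A n \<in> invariant_subgroups (insert t R) Z Y" for n using A(2) by blast
    then have sub: "add_subgroup (A n)" "Z \<subseteq> A n" "A n \<subseteq> Y" "t ` A n \<subseteq> A n"
      "\<And>r. r \<in> R \<Longrightarrow> r ` A n \<subseteq> A n" for n
      by (simp_all add: invariant_subgroups_def)
    have mono: "A i \<subseteq> A j" if "i \<le> j" for i j using A(1) that by (simp add: incseq_def)
    \<comment> \<open>Coefficients in degree \<open>n\<close> of the elements of \<open>A j\<close>
      of degree at most \<open>n\<close>; \<open>y\<close> collects the lower terms.\<close>
    define L where "L n j = {x\<in>X. \<exists>y\<in>D n. (t ^^ n) x + y \<in> A j}" for n j
    have L_inv: "L n j \<in> invariant_subgroups R Z X" for n j
      unfolding invariant_subgroups_def mem_Collect_eq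
    proof (intro conjI ballI)
      show "add_subgroup (L n j)"
        unfolding add_subgroup_def
      proof (intro conjI ballI)
        show "0 \<in> L n j"
          using add_subgroup_zero[OF X(1)] add_subgroup_zero[OF D] add_subgroup_zero[OF sub(1)] tn(3)
          by (force simp: L_def)
      next
        fix a b assume "a \<in> L n j" "b \<in> L n j"
        then obtain x y where *: "a \<in> X" "b \<in> X" "x \<in> D n" "y \<in> D n"
          "(t ^^ n) a + x \<in> A j" "(t ^^ n) b + y \<in> A j" by (auto simp: L_def)
        have "(t ^^ n) (a + b) + (x + y) = ((t ^^ n) a + x) + ((t ^^ n) b + y)"
          by (simp add: tn algebra_simps)
        then have "(t ^^ n) (a + b) + (x + y) \<in> A j" using add_subgroup_add[OF sub(1) *(5,6)] by (simp only:)
        then show "a + b \<in> L n j"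
          unfolding L_def using * add_subgroup_add[OF X(1)] add_subgroup_add[OF D] by blast
      next
        fix a assume "a \<in> L n j"
        then obtain x where *: "a \<in> X" "x \<in> D n" "(t ^^ n) a + x \<in> A j" by (auto simp: L_def)
        have "(t ^^ n) (- a) + - x = - ((t ^^ n) a + x)" by (simp add: tn)
        then have "(t ^^ n) (- a) + - x \<in> A j" using add_subgroup_minus[OF sub(1) *(3)] by (simp only:)
        then show "- a \<in> L n j"
          unfolding L_def using * add_subgroup_minus[OF X(1)] add_subgroup_minus[OF D] by blast
      qed
      show "Z \<subseteq> L n j"
      proof
        fix z assume "z \<in> Z"
        then have "(t ^^ n) z + 0 \<in> A j" "z \<in> X" using tnZ sub(2) X(2) by auto
        then show "z \<in> L n j" using add_subgroup_zero[OF D] unfolding L_def by blast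
      qed
      show "L n j \<subseteq> X" by (auto simp: L_def)
      fix r assume r: "r \<in> R"
      show "r ` L n j \<subseteq> L n j"
      proof
        fix b assume "b \<in> r ` L n j"
        then obtain a x where *: "b = r a" "a \<in> X" "x \<in> D n" "(t ^^ n) a + x \<in> A j" by (auto simp: L_def)
        have "(t ^^ n) (r a) + r x = r ((t ^^ n) a + x)"
          by (simp add: rtn[OF r] Modules.additive.add[OF additive(2)[OF r]])
        then have "(t ^^ n) (r a) + r x \<in> A j" using *(4) sub(5)[OF r] by (metis imageI subsetD)
        then show "b \<in> L n j" using * rD[OF _ r] X(3)[OF r] unfolding L_def by blast
      qed
    qed
    \<comment> \<open>Applying \<open>t\<close> raises the degree by one and keeps the leading
      coefficient.\<close>
    have "L n j \<subseteq> L (Suc n) j" for n j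
    proof
      fix x assume "x \<in> L n j"
      then obtain y where y: "x \<in> X" "y \<in> D n" "(t ^^ n) x + y \<in> A j" by (auto simp: L_def)
      then have "t ((t ^^ n) x + y) \<in> A j" using sub(4) by blast
      then have "(t ^^ Suc n) x + t y \<in> A j" by (simp add: t.add)
      then show "x \<in> L (Suc n) j" using y tD unfolding L_def by blast
    qed
    then have "L n j \<subseteq> L n' j" if "n \<le> n'" for n n' j
      using that by (rule lift_Suc_mono_le[of "\<lambda>n. L n j"])
    moreover have "L n j \<subseteq> L n j'" if "j \<le> j'" for n j j'
      using mono[OF that] unfolding L_def by blast
    ultimately have L_mono: "L n j \<subseteq> L n' j'" if "n \<le> n'" "j \<le> j'" for n n' j j'
      using that by blast
    have L_sub: "{L n j | n j. True} \<subseteq> invariant_subgroups R Z X" using L_inv by auto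
    have L_acc: "\<exists>d. \<forall>n\<ge>d. B n = B d" if "incseq B" "range B \<subseteq> {L n j | n j. True}" for B
      using noeth[unfolded noetherian_def, rule_format, OF that(1) order_trans[OF that(2) L_sub]] .
    obtain d where d: "\<forall>n. \<forall>j\<ge>d. L n j = L n d"
      by (rule incseq2_stabilise[OF L_mono L_acc])
    \<comment> \<open>Induction on the degree: by stability the leading coefficient of
      \<open>v\<close> already occurs in \<open>A d\<close>, and subtracting the element found there
      leaves one of lower degree in \<open>A j\<close>.\<close>
    have "v \<in> A d" if jd: "j \<ge> d" and "v \<in> A j" "v \<in> D n" for v j n
      using that(2,3)
    proof (induction n arbitrary: v)
      case 0
      then show ?case using add_subgroup_zero[OF sub(1)] by (simp add: D0)
    next
      case (Suc n)
      then obtain x y where v: "v = (t ^^ n) x + y" "x \<in> X" "y \<in> D n" unfolding DSuc by blast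
      then have "x \<in> L n j" using Suc.prems by (auto simp: L_def)
      then have "x \<in> L n d" using d jd by blast
      then obtain y' where y': "y' \<in> D n" "(t ^^ n) x + y' \<in> A d" by (auto simp: L_def)
      have "v - ((t ^^ n) x + y') \<in> A j"
        using Suc.prems(1) y'(2) mono[OF jd] add_subgroup_diff[OF sub(1)] by blast
      moreover have "v - ((t ^^ n) x + y') = y - y'" by (simp add: v)
      ultimately have "y - y' \<in> A d" using Suc.IH[of "y - y'"] add_subgroup_diff[OF D v(3) y'(1)] by simp
      then have "(y - y') + ((t ^^ n) x + y') \<in> A d" using y'(2) add_subgroup_add[OF sub(1)] by blast
      then show ?case by (simp add: v algebra_simps)
    qed
    then have "A j \<subseteq> A d" if "j \<ge> d" for j using that sub(3)[of j] unfolding Y_def by blast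
    then show "\<exists>d. \<forall>n\<ge>d. A n = A d" using mono by blast
  qed
  show thesis by (rule that[OF Y XY invY]) (assumption | fact)+
qed

text \<open>Starting from a finitely generated extension of \<open>Z\<close>, the operators are
  adjoined one at a time; commutativity lets each act as a polynomial variable.\<close>

lemma noetherian_finitely_generated_operators:
  assumes "finite R" "finite F" "add_subgroup Z"
    and additive: "\<And>r. r \<in> R \<Longrightarrow> Modules.additive r"
    and comm: "\<And>r s x. r \<in> R \<Longrightarrow> s \<in> R \<Longrightarrow> r (s x) = s (r x)"
    and Z: "\<And>r. r \<in> R \<Longrightarrow> r ` Z \<subseteq> Z"
  obtains Y where "add_subgroup Y" "Z \<union> F \<subseteq> Y" "\<And>r. r \<in> R \<Longrightarrow> r ` Y \<subseteq> Y" "noetherian R Z Y"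
proof -
  have "\<exists>Y. add_subgroup Y \<and> Z \<union> F \<subseteq> Y \<and> (\<forall>r\<in>R. r ` Y \<subseteq> Y) \<and> noetherian R Z Y"
    using assms(1) additive comm Z
  proof (induction R)
    case empty
    obtain X where "add_subgroup X" "Z \<union> F \<subseteq> X" "noetherian {} Z X"
      using noetherian_finitely_generated[OF assms(2,3)] .
    then show ?case by blast
  next
    case (insert t R)
    have "\<exists>X. add_subgroup X \<and> Z \<union> F \<subseteq> X \<and> (\<forall>r\<in>R. r ` X \<subseteq> X) \<and> noetherian R Z X"
      by (rule insert.IH) (simp_all add: insert.prems)
    then obtain X where X: "add_subgroup X" "Z \<union> F \<subseteq> X" "\<forall>r\<in>R. r ` X \<subseteq> X" "noetherian R Z X"
      by blast
    show ?case
    proof (rule noetherian_adjoin_operator[of X Z R t])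
      fix Y assume Y: "add_subgroup Y" "X \<subseteq> Y" "\<And>r. r \<in> insert t R \<Longrightarrow> r ` Y \<subseteq> Y"
        "noetherian (insert t R) Z Y"
      then show ?thesis using X(2) by (intro exI[of _ Y]) blast
    next
      show "t ` Z \<subseteq> Z" by (simp add: insert.prems)
    qed (use X in \<open>auto intro: insert.prems\<close>)
  qed
  then obtain Y where "add_subgroup Y" "Z \<union> F \<subseteq> Y" "\<forall>r\<in>R. r ` Y \<subseteq> Y" "noetherian R Z Y"
    by blast
  then show thesis by (intro that[of Y]) blast+
qed

section \<open>Filtered modules\<close>

text \<open>The associated graded group \<open>\<Oplus>\<^sub>n M (n + 1) / M n\<close> is realised inside the sequences
  \<open>nat \<Rightarrow> 'a\<close> modulo \<open>Z\<close>, and each operator acts on it as a shift of degree one.\<close>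

lemma filtration_eventually_generated:
  fixes M B :: "nat \<Rightarrow> 'a::ab_group_add set" and R :: "('a \<Rightarrow> 'a) set"
  assumes finite: "finite R" "finite F"
    and additive: "\<And>r. r \<in> R \<Longrightarrow> Modules.additive r"
    and comm: "\<And>r s x. r \<in> R \<Longrightarrow> s \<in> R \<Longrightarrow> r (s x) = s (r x)"
    and M: "\<And>n. add_subgroup (M n)" "\<And>r n. r \<in> R \<Longrightarrow> r ` M n \<subseteq> M (Suc n)"
    and gen_1: "M (Suc 0) \<subseteq> subgroup_gen (M 0 \<union> F)"
    and gen_Suc: "\<And>n. M (Suc (Suc n)) \<subseteq> subgroup_gen (M (Suc n) \<union> (\<Union>r\<in>R. r ` M (Suc n)))"
    and B: "\<And>n. B n \<subseteq> M (Suc n)" "\<And>r n. r \<in> R \<Longrightarrow> r ` B n \<subseteq> B (Suc n)"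
  obtains d where "\<forall>n\<ge>d. B (Suc n) \<subseteq> subgroup_gen (M (Suc n) \<union> (\<Union>r\<in>R. r ` B n))"
proof -
  \<comment> \<open>Nothing is shifted into degree 0, hence the value 0 there.\<close>
  define shift :: "('a \<Rightarrow> 'a) \<Rightarrow> (nat \<Rightarrow> 'a) \<Rightarrow> nat \<Rightarrow> 'a"
    where "shift r v = (\<lambda>n. case n of 0 \<Rightarrow> 0 | Suc k \<Rightarrow> r (v k))" for r v
  define single :: "nat \<Rightarrow> 'a \<Rightarrow> nat \<Rightarrow> 'a" where "single n m = (\<lambda>i. if i = n then m else 0)" for n m
  define Z where "Z = {v. \<forall>n. v n \<in> M n}"
  have pointwise: "add_subgroup {v. \<forall>n. v n \<in> A n}"
    if "\<And>n. add_subgroup (A n)" for A :: "nat \<Rightarrow> 'a set"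
    using that unfolding add_subgroup_def by auto
  have shift_additive: "Modules.additive (shift r)" if "r \<in> R" for r
    using Modules.additive.add[OF additive[OF that]]
    by (auto simp: Modules.additive_def shift_def fun_eq_iff split: nat.split)
  have shift_comm: "shift r (shift s v) = shift s (shift r v)" if "r \<in> R" "s \<in> R" for r s v
    using comm[OF that] Modules.additive.zero[OF additive[OF that(1)]]
      Modules.additive.zero[OF additive[OF that(2)]]
    by (auto simp: shift_def fun_eq_iff split: nat.split)
  have shift_Z: "shift r ` Z \<subseteq> Z" if "r \<in> R" for r
    using M(2)[OF that] add_subgroup_zero[OF M(1)]
    by (fastforce simp: shift_def Z_def split: nat.split)
  have Z: "add_subgroup Z" unfolding Z_def by (intro pointwise M)
  obtain Y where Y: "add_subgroup Y" "Z \<union> single 0 ` F \<subseteq> Y" "noetherian (shift ` R) Z Y"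
    and shift_Y: "\<And>r. r \<in> R \<Longrightarrow> shift r ` Y \<subseteq> Y"
  proof (rule noetherian_finitely_generated_operators[of "shift ` R" "single 0 ` F" Z])
    fix f g v assume "f \<in> shift ` R" "g \<in> shift ` R"
    then show "f (g v) = g (f v)" using shift_comm by auto
  next
    fix f assume "f \<in> shift ` R"
    then show "f ` Z \<subseteq> Z" "Modules.additive f" using shift_Z shift_additive by auto
  qed (use finite Z in auto)
  have single_additive: "Modules.additive (single n)" for n
    by (auto simp: Modules.additive_def single_def fun_eq_iff)
  have single_Z: "single n m \<in> Z" if "m \<in> M n" for n m
    using that add_subgroup_zero[OF M(1)] by (auto simp: Z_def single_def)
  have shift_single: "shift r (single n m) = single (Suc n) (r m)" if "r \<in> R" for r n m
    using Modules.additive.zero[OF additive[OF that]]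
    by (auto simp: shift_def single_def fun_eq_iff split: nat.split)
  \<comment> \<open>Degree 0 is generated by \<open>F\<close> modulo \<open>M 0\<close>, and each
    later degree by shifts of the previous one, so \<open>Y\<close> contains every homogeneous
    element.\<close>
  have single_Y: "single n m \<in> Y" if "m \<in> M (Suc n)" for n m
    using that
  proof (induction n arbitrary: m)
    case 0
    then have "m \<in> subgroup_gen (M 0 \<union> F)" using gen_1 by blast
    moreover have "single 0 x \<in> Y" if "x \<in> M 0 \<union> F" for x using that single_Z[of x 0] Y(2) by blast
    ultimately show ?case using additive_subgroup_gen[OF single_additive Y(1)] by blast
  next
    case (Suc n)
    then have m: "m \<in> subgroup_gen (M (Suc n) \<union> (\<Union>r\<in>R. r ` M (Suc n)))" using gen_Suc by blast
    have "single (Suc n) x \<in> Y" if "x \<in> M (Suc n) \<union> (\<Union>r\<in>R. r ` M (Suc n))" for x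
      using that
    proof
      assume "x \<in> M (Suc n)"
      then show ?thesis using single_Z Y(2) by blast
    next
      assume "x \<in> (\<Union>r\<in>R. r ` M (Suc n))"
      then obtain r y where r: "r \<in> R" "y \<in> M (Suc n)" "x = r y" by blast
      then have "shift r (single n y) \<in> Y" using Suc.IH shift_Y by blast
      then show ?thesis using r shift_single by simp
    qed
    then show ?case by (rule additive_subgroup_gen[OF single_additive Y(1) _ m])
  qed
  define H where "H n = subgroup_gen (M (Suc n) \<union> (\<Union>r\<in>R. r ` B n))" for n
  define G where "G n = subgroup_gen (M n \<union> B n)" for n
  have G: "add_subgroup (G n)" "M n \<subseteq> G n" "B n \<subseteq> G n" for n
    unfolding G_def using add_subgroup_subgroup_gen subgroup_gen_superset[of "M n \<union> B n"] by auto
  have H: "add_subgroup (H n)" "M (Suc n) \<subseteq> H n" for n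
    unfolding H_def using add_subgroup_subgroup_gen
      subgroup_gen_superset[of "M (Suc n) \<union> (\<Union>r\<in>R. r ` B n)"] by auto
  have HG: "H n \<subseteq> G (Suc n)" for n
    unfolding H_def G_def using B(2) by (intro subgroup_gen_mono) blast
  have rG: "r x \<in> H n" if "r \<in> R" "x \<in> G n" for r x n
  proof (rule additive_subgroup_gen[OF additive[OF that(1)] H(1) _ that(2)[unfolded G_def]])
    fix y assume "y \<in> M n \<union> B n"
    then have "r y \<in> M (Suc n) \<union> (\<Union>r\<in>R. r ` B n)" using M(2)[OF that(1)] that(1) by blast
    then show "r y \<in> H n" unfolding H_def by (rule subsetD[OF subgroup_gen_superset])
  qed
  \<comment> \<open>Generation from the previous degree is demanded only in degrees above
    \<open>d\<close>, so \<open>W d\<close> grows with \<open>d\<close>. It is stable under shifts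
    because operators map \<open>G n\<close> into \<open>H n\<close>.\<close>
  define W where "W d = {v. (\<forall>n. v n \<in> G n) \<and> (\<forall>n\<ge>d. v (Suc n) \<in> H n)}" for d
  have W: "add_subgroup (W d)" for d
    unfolding W_def
    by (auto simp: add_subgroup_def
        intro: add_subgroup_zero[OF G(1)] add_subgroup_zero[OF H(1)] add_subgroup_add[OF G(1)] add_subgroup_add[OF H(1)]
          add_subgroup_minus[OF G(1)] add_subgroup_minus[OF H(1)])
  have Z_W: "Z \<subseteq> W d" for d
    using G(2) H(2) unfolding W_def Z_def by blast
  have shift_W: "shift r ` W d \<subseteq> W d" if "r \<in> R" for r d
  proof (clarify)
    fix v assume v: "v \<in> W d"
    have "shift r v 0 \<in> G 0" using add_subgroup_zero[OF G(1)] by (simp add: shift_def)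
    moreover have shift_H: "shift r v (Suc k) \<in> H k" for k
      using rG[OF that, of "v k" k] v by (simp add: shift_def W_def)
    ultimately have "shift r v n \<in> G n" for n using HG by (cases n) auto
    with shift_H show "shift r v \<in> W d" unfolding W_def by blast
  qed
  have "shift r ` (Y \<inter> W d) \<subseteq> Y \<inter> W d" if "r \<in> R" for r d
    using shift_Y[OF that] shift_W[OF that] by blast
  then have "Y \<inter> W d \<in> invariant_subgroups (shift ` R) Z Y" for d
    using Y(2) Z_W add_subgroup_Int[OF Y(1) W] unfolding invariant_subgroups_def by simp
  moreover have "incseq (\<lambda>d. Y \<inter> W d)"
  proof -
    have "W d \<subseteq> W d'" if "d \<le> d'" for d d'
      unfolding W_def using that by auto
    then show ?thesis by (auto simp: incseq_def)
  qed
  ultimately obtain d where d: "\<forall>n\<ge>d. Y \<inter> W n = Y \<inter> W d"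
    using noetherianD[OF Y(3)] by blast
  have "b \<in> H n" if n: "n \<ge> d" and b: "b \<in> B (Suc n)" for n b
  proof -
    \<comment> \<open>The constraints of \<open>W (Suc n)\<close> start in degree
      \<open>Suc (Suc n)\<close>, where this sequence vanishes. Since the chain is constant from
      \<open>d\<close> on, the constraint in degree \<open>Suc n\<close> then holds too.\<close>
    have "single (Suc n) b \<in> W (Suc n)"
      using b G(3)[of "Suc n"] add_subgroup_zero[OF G(1)] add_subgroup_zero[OF H(1)]
      by (auto simp: W_def single_def)
    moreover have "single (Suc n) b \<in> Y" using b B(1) single_Y by blast
    ultimately have "single (Suc n) b \<in> W d" using d n by (metis IntD2 IntI le_SucI)
    then have "single (Suc n) b (Suc n) \<in> H n" using n unfolding W_def by blast
    then show ?thesis by (simp add: single_def)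
  qed
  then show thesis using that[of d] unfolding H_def by blast
qed

section \<open>Closed submodules\<close>

lemma submonoid_gen_minimal: "X \<subseteq> A \<Longrightarrow> add_submonoid A \<Longrightarrow> submonoid_gen X \<subseteq> A"
  unfolding submonoid_gen_def by auto

lemma add_subgroup_incseq_Union:
  assumes "incseq A" "\<And>n::nat. add_subgroup (A n)"
  shows "add_subgroup (\<Union>n. A n)"
  unfolding add_subgroup_def
proof (intro conjI ballI)
  show "0 \<in> (\<Union>n. A n)" using add_subgroup_zero[OF assms(2)] by blast
  show "- x \<in> (\<Union>n. A n)" if "x \<in> (\<Union>n. A n)" for x
    using that add_subgroup_minus[OF assms(2)] by blast
  show "x + y \<in> (\<Union>n. A n)" if xy: "x \<in> (\<Union>n. A n)" "y \<in> (\<Union>n. A n)" for x y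
  proof -
    obtain i j where "x \<in> A i" "y \<in> A j" using xy by blast
    then have "x \<in> A (max i j)" "y \<in> A (max i j)"
      using incseqD[OF assms(1)] by (meson max.cobounded1 max.cobounded2 subsetD)+
    then show ?thesis using add_subgroup_add[OF assms(2)] by blast
  qed
qed

text \<open>A compact set of operators acts on the graded quotients through finitely many of its elements:
  by commutativity, two operators that agree on \<open>F\<close> modulo \<open>M 1\<close> agree in every degree.\<close>

lemma compact_operator_filtration:
  fixes act :: "'q::{topological_ab_group_add,t2_space} \<Rightarrow> 'm::{topological_ab_group_add,t2_space} \<Rightarrow> 'm"
  assumes act: "LC_module act" and T: "compact T" and K: "\<And>n. compact (K n)"
    and K_Suc: "\<And>n. K (Suc n) = K n \<union> {act t k | t k. t \<in> T \<and> k \<in> K n}"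
    and V: "open V" "0 \<in> V" "V \<subseteq> K 0"
  obtains F R where "finite F" "finite R" "R \<subseteq> T"
    "subgroup_gen (K (Suc 0)) \<subseteq> subgroup_gen (subgroup_gen (K 0) \<union> F)"
    "\<forall>n. subgroup_gen (K (Suc (Suc n))) \<subseteq>
       subgroup_gen (subgroup_gen (K (Suc n)) \<union> (\<Union>r\<in>R. act r ` subgroup_gen (K (Suc n))))"
proof -
  define M where "M n = subgroup_gen (K n)" for n
  have act_add: "act q (x + y) = act q x + act q y" and act_plus: "act (p + q) x = act p (act q x)"
    for p q x y using act unfolding LC_module_def by auto
  have cont: "continuous_on UNIV (\<lambda>(q, m). act q m)" using act unfolding LC_module_def by auto
  have cont_act: "continuous_on UNIV (\<lambda>q. act q x)" for x
    using continuous_on_compose2[OF cont, of UNIV "\<lambda>q. (q, x)"] by (simp add: continuous_intros)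
  have act_comm: "act p (act q x) = act q (act p x)" for p q x
    by (metis act_plus add.commute)
  have additive: "Modules.additive (act q)" for q by (simp add: Modules.additive_def act_add)
  have act_diff: "act q (x - y) = act q x - act q y" for q x y
    using Modules.additive.diff[OF additive] .
  have M: "add_subgroup (M n)" for n unfolding M_def by (rule add_subgroup_subgroup_gen)
  have KM: "K n \<subseteq> M n" for n unfolding M_def by (rule subgroup_gen_superset)
  have K_mono: "K n \<subseteq> K (Suc n)" for n unfolding K_Suc by blast
  then have K0: "K 0 \<subseteq> K n" for n by (induction n) blast+
  have open_M: "open (M n)" for n
    using open_subgroup(1)[OF M V(1,2)] V(3) K0[of n] KM[of n] by blast
  have act_M: "act t x \<in> M (Suc n)" if "t \<in> T" "x \<in> M n" for t x n
    using that(2) unfolding M_def[of n]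
    by (rule additive_subgroup_gen[OF additive M, rotated])
      (use that(1) KM[of "Suc n"] K_Suc[of n] in blast)
  obtain F where F: "finite F" "F \<subseteq> K (Suc 0)" "\<forall>x\<in>K (Suc 0). \<exists>f\<in>F. x - f \<in> M 0"
    using compact_subset_finite_translates[OF K[of "Suc 0"] open_M[of 0] add_subgroup_zero[OF M]] .
  have gen_1: "M (Suc 0) \<subseteq> subgroup_gen (M 0 \<union> F)"
    unfolding M_def[of "Suc 0"]
  proof (intro subgroup_gen_minimal add_subgroup_subgroup_gen subsetI)
    fix x assume "x \<in> K (Suc 0)"
    then obtain f where "f \<in> F" "x - f \<in> M 0" using F(3) by blast
    then have "(x - f) + f \<in> subgroup_gen (M 0 \<union> F)"
      using subgroup_gen_superset[of "M 0 \<union> F"]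
      by (intro add_subgroup_add[OF add_subgroup_subgroup_gen]) blast+
    then show "x \<in> subgroup_gen (M 0 \<union> F)" by simp
  qed
  \<comment> \<open>The operators agreeing with \<open>t\<close> on \<open>F\<close> modulo
    \<open>M (Suc 0)\<close>: an open set as \<open>F\<close> is finite, so finitely many of these
    sets cover \<open>T\<close>.\<close>
  define N where "N t = (\<Inter>f\<in>F. {s. act s f - act t f \<in> M (Suc 0)})" for t
  have "open (N t)" for t
  proof -
    have "open {s. act s f - act t f \<in> M (Suc 0)}" for f
      using open_vimage[OF open_M[of "Suc 0"], of "\<lambda>s. act s f - act t f"] cont_act
      by (simp add: vimage_def continuous_intros)
    then show ?thesis unfolding N_def using F(1) by blast
  qed
  moreover have "T \<subseteq> (\<Union>t\<in>T. N t)" using add_subgroup_zero[OF M] by (auto simp: N_def)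
  ultimately obtain R where R: "R \<subseteq> T" "finite R" "T \<subseteq> (\<Union>t\<in>R. N t)"
    using compactE_image[OF T, of T N] by metis
  \<comment> \<open>Each of \<open>act t x\<close> and \<open>act r x\<close> lies in
    \<open>M (Suc (Suc n))\<close>; their difference drops one level. For a generator
    \<open>act s k\<close>, commutativity moves the difference onto \<open>k\<close>, one level
    lower.\<close>
  have same_action: "\<exists>r\<in>R. \<forall>n. \<forall>x\<in>M (Suc n). act t x - act r x \<in> M (Suc n)" if t: "t \<in> T" for t
  proof -
    obtain r where r: "r \<in> R" "t \<in> N r" using R(3) t by blast
    have rT: "r \<in> T" using r R by blast
    have diff: "Modules.additive (\<lambda>x. act t x - act r x)"
      by (simp add: Modules.additive_def act_add)
    have "act t x - act r x \<in> M (Suc n)" if "x \<in> M (Suc n)" for n x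
      using that
    proof (induction n arbitrary: x)
      case 0
      show ?case
      proof (rule additive_subgroup_gen[OF diff M, of "M 0 \<union> F"])
        show "x \<in> subgroup_gen (M 0 \<union> F)" using gen_1 0 by blast
        fix y assume "y \<in> M 0 \<union> F"
        then show "act t y - act r y \<in> M (Suc 0)"
        proof
          assume "y \<in> M 0"
          then show ?thesis using act_M t rT by (intro add_subgroup_diff[OF M]) auto
        next
          assume "y \<in> F"
          then show ?thesis using r(2) by (auto simp: N_def)
        qed
      qed
    next
      case (Suc n)
      show ?case
      proof (rule additive_subgroup_gen[OF diff M, of "K (Suc (Suc n))"])
        show "x \<in> subgroup_gen (K (Suc (Suc n)))" using Suc.prems by (simp add: M_def)
        fix y assume "y \<in> K (Suc (Suc n))"
        then consider "y \<in> K (Suc n)" | s k where "y = act s k" "s \<in> T" "k \<in> K (Suc n)"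
          unfolding K_Suc[of "Suc n"] by blast
        then show "act t y - act r y \<in> M (Suc (Suc n))"
        proof cases
          case 1
          then show ?thesis using act_M[OF _ subsetD[OF KM]] t rT by (intro add_subgroup_diff[OF M]) auto
        next
          case 2
          have "act t y - act r y = act s (act t k - act r k)"
            by (simp add: 2 act_diff act_comm[of _ s])
          moreover have "act t k - act r k \<in> M (Suc n)" using Suc.IH[of k] KM 2 by blast
          ultimately show ?thesis using act_M[OF 2(2)] by simp
        qed
      qed
    qed
    with r show ?thesis by blast
  qed
  have "M (Suc (Suc n)) \<subseteq> subgroup_gen (M (Suc n) \<union> (\<Union>r\<in>R. act r ` M (Suc n)))" (is "_ \<subseteq> ?G") for n
    unfolding M_def[of "Suc (Suc n)"]
  proof (intro subgroup_gen_minimal add_subgroup_subgroup_gen subsetI)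
    fix x assume "x \<in> K (Suc (Suc n))"
    then consider "x \<in> K (Suc n)" | s k where "x = act s k" "s \<in> T" "k \<in> K (Suc n)"
      unfolding K_Suc[of "Suc n"] by blast
    then show "x \<in> ?G"
    proof cases
      case 1
      then show ?thesis
        using KM[of "Suc n"] subgroup_gen_superset[of "M (Suc n) \<union> (\<Union>r\<in>R. act r ` M (Suc n))"] by blast
    next
      case 2
      have k: "k \<in> M (Suc n)" using KM 2 by blast
      then obtain r where r: "r \<in> R" "act s k - act r k \<in> M (Suc n)" using same_action[OF 2(2)] by blast
      have "(act s k - act r k) + act r k \<in> ?G"
        using r k subgroup_gen_superset[of "M (Suc n) \<union> (\<Union>r\<in>R. act r ` M (Suc n))"]
        by (intro add_subgroup_add[OF add_subgroup_subgroup_gen]) blast+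
      then show ?thesis by (simp add: 2)
    qed
  qed
  then show thesis using that[OF F(1) R(2,1)] gen_1 unfolding M_def by blast
qed

lemma closed_submodule_compactly_generated_over:
  fixes act :: "'q::{topological_ab_group_add,t2_space} \<Rightarrow> 'm::{topological_ab_group_add,t2_space} \<Rightarrow> 'm"
  assumes act: "LC_module act" and N: "closed_submodule act N"
    and S: "compactly_generated_submonoid S" and gen: "compactly_generated_over act S UNIV"
  shows "compactly_generated_over act S N"
proof -
  have act_add: "act q (x + y) = act q x + act q y" and act_plus: "act (p + q) x = act p (act q x)"
    and act_0: "act 0 x = x"
    for p q x y using act unfolding LC_module_def by auto
  have cont: "continuous_on UNIV (\<lambda>(q, m). act q m)" using act unfolding LC_module_def by auto
  have additive: "Modules.additive (act q)" for q by (simp add: Modules.additive_def act_add)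
  have N_sub: "add_subgroup N" and N_closed: "closed N" and N_act: "\<And>q x. x \<in> N \<Longrightarrow> act q x \<in> N"
    using N unfolding closed_submodule_def by auto
  obtain T where T: "compact T" "T \<subseteq> S" "submonoid_gen T = S" and S': "add_submonoid S"
    using S unfolding compactly_generated_submonoid_def by auto
  obtain K0 where K0: "compact K0" "UNIV = subgroup_gen {act s k | s k. s \<in> S \<and> k \<in> K0}"
    using gen unfolding compactly_generated_over_def by auto
  have "locally_compact_space (euclidean :: 'm topology)"
    using act unfolding LC_module_def LCA_group_def by auto
  then have "\<forall>x::'m. \<exists>U C. open U \<and> compact C \<and> x \<in> U \<and> U \<subseteq> C"
    by (simp add: locally_compact_space_def)
  then obtain V C where V: "open V" "compact C" "(0::'m) \<in> V" "V \<subseteq> C"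
    by (auto dest!: spec[of _ 0])
  \<comment> \<open>\<open>K n\<close> collects the images of \<open>K0 \<union> C\<close> under
    products of at most \<open>n\<close> elements of \<open>T\<close>. Including \<open>C\<close>
    makes every \<open>M n\<close> contain a neighbourhood of 0.\<close>
  define K where "K = rec_nat (K0 \<union> C) (\<lambda>_ X. X \<union> {act t k | t k. t \<in> T \<and> k \<in> X})"
  have K_0: "K 0 = K0 \<union> C" and K_Suc: "K (Suc n) = K n \<union> {act t k | t k. t \<in> T \<and> k \<in> K n}" for n
    by (simp_all add: K_def)
  have K: "compact (K n)" for n
  proof (induction n)
    case 0
    then show ?case using K0 V by (simp add: K_0 compact_Un)
  next
    case (Suc n)
    have "{act t k | t k. t \<in> T \<and> k \<in> K n} = (\<lambda>(q, m). act q m) ` (T \<times> K n)" by auto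
    moreover have "compact ((\<lambda>(q, m). act q m) ` (T \<times> K n))"
      using continuous_on_subset[OF cont subset_UNIV] compact_Times[OF T(1) Suc]
      by (rule compact_continuous_image)
    ultimately show ?case unfolding K_Suc using Suc by (simp add: compact_Un)
  qed
  define M where "M n = subgroup_gen (K n)" for n
  have M: "add_subgroup (M n)" for n unfolding M_def by (rule add_subgroup_subgroup_gen)
  have KM: "K n \<subseteq> M n" for n unfolding M_def by (rule subgroup_gen_superset)
  have K_mono: "K n \<subseteq> K (Suc n)" for n unfolding K_Suc by blast
  then have VK: "V \<subseteq> K n" for n
    by (induction n) (use V(4) K_0 in blast)+
  have incM: "incseq M"
    unfolding M_def by (intro incseq_SucI subgroup_gen_mono K_mono)
  have closed_M: "closed (M n)" for n
    using open_subgroup(2)[OF M V(1,3)] VK[of n] KM[of n] by blast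
  have act_M: "act t ` M n \<subseteq> M (Suc n)" if "t \<in> T" for t n
  proof clarify
    fix x assume "x \<in> M n"
    then show "act t x \<in> M (Suc n)"
      unfolding M_def[of n]
      by (rule additive_subgroup_gen[OF additive M, rotated])
        (use that KM[of "Suc n"] K_Suc[of n] in blast)
  qed
  have M_UNIV: "(\<Union>n. M n) = UNIV"
  proof -
    \<comment> \<open>The operators preserving the union of the \<open>K n\<close> form a submonoid
      containing \<open>T\<close>, hence all of \<open>S\<close>.\<close>
    let ?P = "{s. \<forall>x\<in>(\<Union>n. K n). act s x \<in> (\<Union>n. K n)}"
    have "add_submonoid ?P" unfolding add_submonoid_def by (simp add: act_0 act_plus) blast
    moreover have "T \<subseteq> ?P" using K_Suc by blast
    ultimately have S_P: "S \<subseteq> ?P" using submonoid_gen_minimal[of T ?P] T(3) by simp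
    have "act s k \<in> (\<Union>n. M n)" if "s \<in> S" "k \<in> K0" for s k
    proof -
      have "k \<in> K 0" using that(2) K_0 by blast
      then have "act s k \<in> (\<Union>n. K n)" using S_P that(1) by blast
      then show ?thesis using KM by blast
    qed
    then have "subgroup_gen {act s k | s k. s \<in> S \<and> k \<in> K0} \<subseteq> (\<Union>n. M n)"
      by (intro subgroup_gen_minimal add_subgroup_incseq_Union incM M) blast
    then show ?thesis using K0(2) by blast
  qed
  obtain F R where FR: "finite F" "finite R" "R \<subseteq> T" "M (Suc 0) \<subseteq> subgroup_gen (M 0 \<union> F)"
    "\<forall>n. M (Suc (Suc n)) \<subseteq> subgroup_gen (M (Suc n) \<union> (\<Union>r\<in>R. act r ` M (Suc n)))"
    using compact_operator_filtration[where act = act and K = K, OF act T(1) K K_Suc V(1,3) VK] unfolding M_def .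
  \<comment> \<open>The shift by one puts \<open>B n\<close> in degree \<open>n\<close> of the
    graded group, which is \<open>M (Suc n)\<close> modulo \<open>M n\<close>.\<close>
  define B where "B n = N \<inter> M (Suc n)" for n
  obtain d where d: "\<forall>n\<ge>d. B (Suc n) \<subseteq> subgroup_gen (M (Suc n) \<union> (\<Union>f\<in>act ` R. f ` B n))"
  proof (rule filtration_eventually_generated[of "act ` R" F M B])
    fix f g x assume "f \<in> act ` R" "g \<in> act ` R"
    then show "f (g x) = g (f x)" by (auto simp flip: act_plus simp: add.commute)
  next
    fix f n assume f: "f \<in> act ` R"
    then show "f ` M n \<subseteq> M (Suc n)" using act_M FR(3) by blast
    show "f ` B n \<subseteq> B (Suc n)"
      using f act_M FR(3) N_act unfolding B_def by blast
  qed (use FR M additive in \<open>auto simp: B_def\<close>)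
  have B_closed: "closed (B d)" and B_sub: "add_subgroup (B d)"
    unfolding B_def using N_closed N_sub M closed_M by (auto intro: add_subgroup_Int)
  obtain L where L: "compact L" "L \<subseteq> B d" "subgroup_gen L = B d"
    using closed_subgroup_compactly_generated[OF K[of "Suc d"] V(1,3) VK B_sub B_closed]
    unfolding B_def M_def by blast
  define H where "H = subgroup_gen {act s k | s k. s \<in> S \<and> k \<in> L}"
  have H: "add_subgroup H" unfolding H_def by (rule add_subgroup_subgroup_gen)
  have act_H: "act t x \<in> H" if t: "t \<in> T" and x: "x \<in> H" for t x
    using x unfolding H_def
  proof (rule additive_subgroup_gen[OF additive add_subgroup_subgroup_gen, rotated])
    fix y assume "y \<in> {act s k | s k. s \<in> S \<and> k \<in> L}"
    then obtain s k where y: "y = act s k" "s \<in> S" "k \<in> L" by blast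
    have "t + s \<in> S" using S' t T(2) y(2) unfolding add_submonoid_def by blast
    then have "act t y \<in> {act s k | s k. s \<in> S \<and> k \<in> L}" using y by (auto simp flip: act_plus)
    then show "act t y \<in> subgroup_gen {act s k | s k. s \<in> S \<and> k \<in> L}"
      by (rule subsetD[OF subgroup_gen_superset])
  qed
  have HN: "H \<subseteq> N"
    unfolding H_def using L(2) N_act by (intro subgroup_gen_minimal N_sub) (auto simp: B_def)
  have "L \<subseteq> H"
  proof
    fix x assume "x \<in> L"
    moreover have "0 \<in> S" using S' unfolding add_submonoid_def by blast
    ultimately have "act 0 x \<in> H" unfolding H_def
      using subgroup_gen_superset[of "{act s k | s k. s \<in> S \<and> k \<in> L}"] by blast
    then show "x \<in> H" by (simp add: act_0)
  qed
  then have BdH: "B d \<subseteq> H" using L(3) subgroup_gen_minimal[OF _ H] by blast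
  have BH: "B n \<subseteq> H" if "d \<le> n" for n
    using that
  proof (induction n rule: dec_induct)
    case base
    then show ?case by (rule BdH)
  next
    case (step n)
    show ?case
    proof
      fix b assume b: "b \<in> B (Suc n)"
      then have "b \<in> subgroup_gen (M (Suc n) \<union> (\<Union>f\<in>act ` R. f ` B n))" using d step by blast
      then obtain a c where ac: "a \<in> M (Suc n)" "c \<in> subgroup_gen (\<Union>f\<in>act ` R. f ` B n)" "b = a + c"
        by (rule subgroup_gen_Un_subgroup[OF M])
      have "(\<Union>f\<in>act ` R. f ` B n) \<subseteq> H" using act_H step.IH FR(3) by blast
      then have c: "c \<in> H" using ac(2) subgroup_gen_minimal[OF _ H] by blast
      \<comment> \<open>Since \<open>c\<close> lies in \<open>H\<close> and so in \<open>N\<close>,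
        the remainder \<open>a\<close> lies in \<open>N\<close> as well as in
        \<open>M (Suc n)\<close>, that is, in \<open>B n\<close>.\<close>
      have "b - c \<in> N" using b c HN by (intro add_subgroup_diff N_sub) (auto simp: B_def)
      then have "a \<in> B n" using ac by (simp add: B_def)
      then show "b \<in> H" using step.IH c ac(3) add_subgroup_add[OF H] by blast
    qed
  qed
  have "N \<subseteq> H"
  proof
    fix x assume x: "x \<in> N"
    obtain n where "x \<in> M n" using M_UNIV by blast
    \<comment> \<open>The index is raised to at least \<open>d\<close>, where \<open>BH\<close>
      applies.\<close>
    moreover have "n \<le> Suc (max n d)" by simp
    ultimately have "x \<in> M (Suc (max n d))" using incseqD[OF incM] by blast
    then show "x \<in> H" using BH[of "max n d"] x by (auto simp: B_def)
  qed
  then have "N = subgroup_gen {act s k | s k. s \<in> S \<and> k \<in> L}" using HN unfolding H_def by blast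
  moreover have "L \<subseteq> N" using L(2) by (auto simp: B_def)
  ultimately show ?thesis unfolding compactly_generated_over_def using L(1) by blast
qed

theorem mainTheorem18:
  fixes act :: "'q::{topological_ab_group_add,t2_space} \<Rightarrow> 'm::{topological_ab_group_add,t2_space} \<Rightarrow> 'm"
    and N :: "'m set"
  assumes "LCA_group TYPE('q)"
    and "compactly_generated_group TYPE('q)"
    and "LC_module act"
    and "closed_submodule act N"
  shows "Gamma_Q act N \<subseteq> Gamma_Q act (UNIV :: 'm set)"
  \<comment> \<open>By contraposition: a submonoid \<open>S\<close> excluding \<open>chi\<close> for
    the whole module excludes it for \<open>N\<close>, and the zero character belongs to both
    sides.\<close>
  using closed_submodule_compactly_generated_over[OF assms(3,4)] unfolding Gamma_Q_def by blast

end
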